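(* Every finite connected arc-transitive circulant is a CI-circulant. That is, if $G$ is a finite cyclic group and $S$ is a nonempty subset of $G$ such that $\mathrm{Cay}(G,S)$ is connected and arc-transitive, then for every subset $T\subseteq G$ with $\mathrm{Cay}(G,S)\cong\mathrm{Cay}(G,T)$ there exists $\alpha\in\mathrm{Aut}(G)$ with $T=S^\alpha$.
   Context: A digraph is a pair $(V,A)$ with $A\subseteq V\times V$; it is connected if its underlying undirected graph is connected, and arc-transitive if its automorphism group is transitive on $A$. For a group $G$ and nonempty $S\subseteq G$, the Cayley digraph $\mathrm{Cay}(G,S)$ has vertex set $G$, with $x$ pointing to $y$ iff $yx^{-1}\in S$. A Cayley digraph $\mathrm{Cay}(G,S)$ of a cyclic group $G$ is a CI-circulant if for each $T\subseteq G$ with $\mathrm{Cay}(G,S)\cong\mathrm{Cay}(G,T)$ there is $\alpha\in\mathrm{Aut}(G)$ with $T=S^\alpha$. A circulant is a digraph isomorphic to a Cayley digraph of a finite cyclic group. *)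

theory Defs
  imports "HOL-Algebra.Algebra"
begin

(* Finite cyclic group: a group generated by a single element, with finite carrier. *)
definition cyclic_group :: "('a, 'b) monoid_scheme \<Rightarrow> bool" where
  "cyclic_group G \<longleftrightarrow> group G \<and> (\<exists>g\<in>carrier G. generate G {g} = carrier G)"

(* Arc set of the Cayley digraph Cay(G,S): x points to y iff y x^{-1} \<in> S. *)
definition cay_arcs :: "('a, 'b) monoid_scheme \<Rightarrow> 'a set \<Rightarrow> ('a \<times> 'a) set" where
  "cay_arcs G S = {(x, y). x \<in> carrier G \<and> y \<in> carrier G \<and> y \<otimes>\<^bsub>G\<^esub> inv\<^bsub>G\<^esub> x \<in> S}"

(* A digraph is a pair (V, A) with A \<subseteq> V \<times> V. *)

(* Connected: the underlying undirected graph is connected. *)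
definition digraph_connected :: "'a set \<Rightarrow> ('a \<times> 'a) set \<Rightarrow> bool" where
  "digraph_connected V A \<longleftrightarrow> (\<forall>x\<in>V. \<forall>y\<in>V. (x, y) \<in> (A \<union> A\<inverse>)\<^sup>*)"

(* Digraph isomorphism from (V,A) to (W,B). *)
definition digraph_iso :: "('a \<Rightarrow> 'c) \<Rightarrow> 'a set \<Rightarrow> ('a \<times> 'a) set \<Rightarrow> 'c set \<Rightarrow> ('c \<times> 'c) set \<Rightarrow> bool" where
  "digraph_iso f V A W B \<longleftrightarrow> bij_betw f V W \<and>
     (\<forall>x\<in>V. \<forall>y\<in>V. (x, y) \<in> A \<longleftrightarrow> (f x, f y) \<in> B)"

definition digraphs_isomorphic :: "'a set \<Rightarrow> ('a \<times> 'a) set \<Rightarrow> 'c set \<Rightarrow> ('c \<times> 'c) set \<Rightarrow> bool" where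
  "digraphs_isomorphic V A W B \<longleftrightarrow> (\<exists>f. digraph_iso f V A W B)"

(* Arc-transitive: Aut(V,A) is transitive on A. *)
definition arc_transitive :: "'a set \<Rightarrow> ('a \<times> 'a) set \<Rightarrow> bool" where
  "arc_transitive V A \<longleftrightarrow> (\<forall>a\<in>A. \<forall>b\<in>A. \<exists>f. digraph_iso f V A V A \<and> (f (fst a), f (snd a)) = b)"

end

(* Let f be an isomorphism of circulants on Z/n with connection sets S and T and f(0) = 0. Counting
   walks of length p modulo p, for a prime p, shows that f maps u S to u T for all units u, and that
   for p dividing n the y for which the number of s in S with p s = y is not divisible by p generate
   a subgroup H_p whose cosets are blocks of the automorphism group. If S is periodic, one divides
   out its periods. Otherwise, if H_p = p Z/n for all p, then S and T consist of generators, S is an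
   orbit of a group of units, and f(s) = u s gives T = u S. If some H = H_p is smaller, then S is
   P-periodic outside H + P, where P has order p, so translations by P on single cosets of H + P are
   automorphisms. A Jordan-set argument makes the pointwise stabiliser of H transitive on the other
   cosets of H. Its orbits provide a block system of a complement M of H for which S is, outside H,
   a union of cosets of M, and one divides out M. *)
theory Submission
  imports Defs "HOL-Number_Theory.Cong" "HOL-Computational_Algebra.Polynomial"
begin

hide_const (open) Divisibility.prime

section \<open>Periodic sets of integers and isomorphisms of circulants\<close>

text \<open>An isomorphism of circulants is a mere bijection of Z/n, so a priori only graph
  invariants are available. Walks of prime length are the ones that see the group: modulo p, the
  p-th power in the group ring is additive and sends the indicator of S to that of p S, counted with
  multiplicity. For p prime to n this gives a multiplication that f must respect; for p dividing n
  it leaves only multiplicities modulo p. The three cases match three shapes of the digraph: a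
  lexicographic product with an empty digraph, a set of units, and the direct product of a circulant
  on H with the loopless complete digraph on M. In the first and third shape the multiplier is found
  on a quotient and lifted to a unit of Z/n, and every unit preserves H. The obstacle is to
  recognise the third shape: a local translation moves points in one coset of H + P only and says
  nothing about how different cosets are related.\<close>

definition periodic :: "int \<Rightarrow> int set \<Rightarrow> bool" where
  "periodic n A \<longleftrightarrow> (\<forall>x y. [x = y] (mod n) \<longrightarrow> x \<in> A \<longrightarrow> y \<in> A)"

text \<open>Subsets of \<open>\<int>/n\<close> are encoded as \<open>n\<close>-periodic sets of integers, and maps of \<open>\<int>/n\<close> as maps
  of integers that are only meaningful modulo \<open>n\<close>. Passing to a quotient of \<open>\<int>/n\<close> then just means
  passing to a divisor of \<open>n\<close>.\<close>

definition ciso :: "int \<Rightarrow> int set \<Rightarrow> int set \<Rightarrow> (int \<Rightarrow> int) \<Rightarrow> bool" where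
  "ciso n S T f \<longleftrightarrow> (\<forall>x y. [f x = f y] (mod n) \<longleftrightarrow> [x = y] (mod n)) \<and>
     (\<forall>y. \<exists>x. [f x = y] (mod n)) \<and> (\<forall>x y. f y - f x \<in> T \<longleftrightarrow> y - x \<in> S)"

definition residues_of :: "int \<Rightarrow> int set \<Rightarrow> int set" where
  "residues_of n A = A \<inter> {0..<n}"

definition rcount :: "int \<Rightarrow> int set \<Rightarrow> nat" where
  "rcount n A = card (residues_of n A)"

definition dilate :: "int \<Rightarrow> int \<Rightarrow> int set \<Rightarrow> int set" where
  "dilate n u A = {y. \<exists>x\<in>A. [y = u * x] (mod n)}"

text \<open>For \<open>d\<close> dividing \<open>n\<close> this is the image of \<open>A\<close> in
  Z/d, again written as a periodic set of integers: the connection set of a quotient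
  digraph.\<close>

definition saturate :: "int \<Rightarrow> int set \<Rightarrow> int set" where
  "saturate d A = {y. \<exists>x\<in>A. [y = x] (mod d)}"

lemma periodicD: "periodic n A \<Longrightarrow> [x = y] (mod n) \<Longrightarrow> x \<in> A \<longleftrightarrow> y \<in> A"
  unfolding periodic_def using cong_sym by blast

lemma periodic_Un: "periodic n A \<Longrightarrow> periodic n B \<Longrightarrow> periodic n (A \<union> B)"
  unfolding periodic_def by blast

lemma periodic_saturate: "periodic d (saturate d A)"
  unfolding periodic_def saturate_def by (blast intro: cong_trans cong_sym)

lemma periodic_dilate: "periodic n (dilate n u A)"
  unfolding periodic_def dilate_def by (blast intro: cong_trans cong_sym)

lemma saturate_periodic: "periodic d A \<Longrightarrow> saturate d A = A"
  unfolding saturate_def by (auto simp: periodicD intro: cong_refl)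

lemma periodic_multiples: "d dvd n \<Longrightarrow> periodic n {x. (d::int) dvd x}"
  unfolding periodic_def using cong_dvd_iff cong_dvd_modulus by blast

lemma mod_mem_periodic: "periodic n A \<Longrightarrow> x mod n \<in> A \<longleftrightarrow> x \<in> A"
  using periodicD[of n A "x mod n" x] by (simp add: cong_def)

lemma ciso_cong: "ciso n S T f \<Longrightarrow> [f x = f y] (mod n) \<longleftrightarrow> [x = y] (mod n)"
  by (simp add: ciso_def)

lemma ciso_surj: "ciso n S T f \<Longrightarrow> \<exists>x. [f x = y] (mod n)"
  by (simp add: ciso_def)

lemma ciso_diff: "ciso n S T f \<Longrightarrow> f y - f x \<in> T \<longleftrightarrow> y - x \<in> S"
  by (simp add: ciso_def)

lemma cisoI:
  assumes "\<And>x y. [f x = f y] (mod n) \<longleftrightarrow> [x = y] (mod n)" "\<And>y. \<exists>x. [f x = y] (mod n)"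
    "\<And>x y. f y - f x \<in> T \<longleftrightarrow> y - x \<in> S"
  shows "ciso n S T f"
  using assms by (simp add: ciso_def)

lemma ciso_mem:
  assumes "ciso n S T f" "periodic n T" "[f 0 = 0] (mod n)"
  shows "f x \<in> T \<longleftrightarrow> x \<in> S"
proof -
  have "[f x - f 0 = f x] (mod n)"
    using cong_diff[OF cong_refl assms(3), of "f x"] by simp
  then show ?thesis
    using periodicD[OF assms(2)] ciso_diff[OF assms(1), of x 0] by simp
qed

lemma ciso_id: "ciso n S S (\<lambda>x. x)"
  by (rule cisoI) (auto intro: cong_refl)

lemma ciso_comp:
  assumes "ciso n S T f" "ciso n T U g"
  shows "ciso n S U (\<lambda>x. g (f x))"
proof (rule cisoI)
  fix y
  obtain z where z: "[g z = y] (mod n)" using ciso_surj[OF assms(2)] by blast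
  obtain x where "[f x = z] (mod n)" using ciso_surj[OF assms(1)] by blast
  then have "[g (f x) = g z] (mod n)" using ciso_cong[OF assms(2)] by blast
  then show "\<exists>x. [g (f x) = y] (mod n)" using z cong_trans by blast
qed (use assms in \<open>auto simp: ciso_def\<close>)

lemma ciso_shift:
  assumes "ciso n S T f"
  shows "ciso n S T (\<lambda>x. f (x + a) + b)"
proof (rule cisoI)
  fix y
  obtain z where z: "[f z = y - b] (mod n)" using ciso_surj[OF assms] by blast
  then have "[f ((z - a) + a) + b = y] (mod n)"
    using cong_add[OF z cong_refl[of b]] by simp
  then show "\<exists>x. [f (x + a) + b = y] (mod n)" by blast
next
  fix x y
  show "[f (x + a) + b = f (y + a) + b] (mod n) \<longleftrightarrow> [x = y] (mod n)"
    using ciso_cong[OF assms, of "x + a" "y + a"] by (simp add: cong_iff_dvd_diff)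
  show "f (y + a) + b - (f (x + a) + b) \<in> T \<longleftrightarrow> y - x \<in> S"
    using ciso_diff[OF assms, of "y + a" "x + a"] by simp
qed

lemma ciso_base:
  assumes "ciso n S T f"
  shows "ciso n S T (\<lambda>x. f (x + a) - f a)"
  using ciso_shift[OF assms, of a "- f a"] by simp

lemma ciso_translation: "ciso n S S (\<lambda>x. x + a)"
  using ciso_shift[OF ciso_id, of n S 0 a] by simp

lemma ciso_inv:
  assumes "ciso n S T f" "periodic n T"
  obtains g where "ciso n T S g" "\<And>x. [g (f x) = x] (mod n)" "\<And>y. [f (g y) = y] (mod n)"
proof -
  obtain g where g: "\<And>y. [f (g y) = y] (mod n)"
    using ciso_surj[OF assms(1)] by metis
  have gf: "[g (f x) = x] (mod n)" for x
    using g[of "f x"] ciso_cong[OF assms(1)] by blast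
  have "ciso n T S g"
  proof (rule cisoI)
    fix x y
    show "[g x = g y] (mod n) \<longleftrightarrow> [x = y] (mod n)"
      using ciso_cong[OF assms(1), of "g x" "g y"] g cong_trans cong_sym by metis
    show "g y - g x \<in> S \<longleftrightarrow> y - x \<in> T"
      using ciso_diff[OF assms(1), of "g y" "g x"] periodicD[OF assms(2) cong_diff[OF g g]] by blast
  qed (use gf in blast)
  then show thesis using that g gf by blast
qed

lemma zero_cong_inv:
  assumes "ciso n S T f" "\<And>x. [g (f x) = x] (mod n)" "\<And>y. [f (g y) = y] (mod n)" "[f 0 = 0] (mod n)"
  shows "[g 0 = 0] (mod n)"
proof -
  have "[f (g 0) = f 0] (mod n)" using assms(3)[of 0] assms(4) cong_trans cong_sym by blast
  then show ?thesis using ciso_cong[OF assms(1)] by blast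
qed

section \<open>Counting the residue classes of a periodic set\<close>

lemma finite_residues_of [simp]: "finite (residues_of n A)"
  by (simp add: residues_of_def)

lemma rcount_le:
  assumes "n > 0" "periodic n B"
    and inj: "\<And>x y. x \<in> A \<Longrightarrow> y \<in> A \<Longrightarrow> [f x = f y] (mod n) \<Longrightarrow> [x = y] (mod n)"
    and im: "\<And>x. x \<in> A \<Longrightarrow> f x \<in> B"
  shows "rcount n A \<le> rcount n B"
  unfolding rcount_def
proof (rule card_inj_on_le[where f = "\<lambda>x. f x mod n"])
  show "inj_on (\<lambda>x. f x mod n) (residues_of n A)"
  proof (rule inj_onI)
    fix x y assume *: "x \<in> residues_of n A" "y \<in> residues_of n A" "f x mod n = f y mod n"
    then have "[x = y] (mod n)" using inj[of x y] by (simp add: residues_of_def cong_def)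
    then show "x = y" using *(1,2) cong_less_imp_eq_int[of x n y] by (simp add: residues_of_def)
  qed
  show "(\<lambda>x. f x mod n) ` residues_of n A \<subseteq> residues_of n B"
    using im assms(1) by (auto simp: residues_of_def mod_mem_periodic[OF assms(2)])
qed simp

lemma rcount_eq:
  assumes "n > 0" "periodic n A" "periodic n B"
    and cong: "\<And>x y. [f x = f y] (mod n) \<longleftrightarrow> [x = y] (mod n)"
    and im: "\<And>x. x \<in> A \<Longrightarrow> f x \<in> B"
    and onto: "\<And>y. y \<in> B \<Longrightarrow> \<exists>x\<in>A. [f x = y] (mod n)"
  shows "rcount n A = rcount n B"
proof (rule antisym)
  show "rcount n A \<le> rcount n B" using assms by (intro rcount_le[of n B A f]) auto
  obtain g where g: "\<And>y. y \<in> B \<Longrightarrow> g y \<in> A \<and> [f (g y) = y] (mod n)" using onto by metis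
  have "[x = y] (mod n)" if "x \<in> B" "y \<in> B" "[g x = g y] (mod n)" for x y
    using that cong[of "g x" "g y"] g cong_trans cong_sym by meson
  then show "rcount n B \<le> rcount n A" using g assms by (intro rcount_le[of n A B g]) auto
qed

lemma rcount_ciso:
  assumes "n > 0" "periodic n A" "periodic n B" "ciso n S T f" "\<And>x. f x \<in> B \<longleftrightarrow> x \<in> A"
  shows "rcount n A = rcount n B"
proof (rule rcount_eq[of n A B f])
  fix y assume "y \<in> B"
  moreover obtain x where "[f x = y] (mod n)" using ciso_surj[OF assms(4)] by blast
  ultimately show "\<exists>x\<in>A. [f x = y] (mod n)" using periodicD[OF assms(3)] assms(5) by blast
qed (use assms ciso_cong[OF assms(4)] in auto)

lemma rcount_mono: "A \<subseteq> B \<Longrightarrow> rcount n A \<le> rcount n B"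
  unfolding rcount_def by (rule card_mono) (auto simp: residues_of_def)

lemma rcount_subset_eq:
  assumes "n > 0" "periodic n A" "periodic n B" "A \<subseteq> B" "rcount n B \<le> rcount n A"
  shows "A = B"
proof -
  have "residues_of n A = residues_of n B"
    using assms(4,5) by (intro card_seteq) (auto simp: residues_of_def rcount_def)
  have "y \<in> A" if "y \<in> B" for y
  proof -
    have "y mod n \<in> residues_of n B"
      using that mod_mem_periodic[OF assms(3)] assms(1) by (simp add: residues_of_def)
    then have "y mod n \<in> residues_of n A" using \<open>residues_of n A = _\<close> by blast
    then show ?thesis using mod_mem_periodic[OF assms(2)] by (simp add: residues_of_def)
  qed
  then show ?thesis using assms(4) by blast
qed

lemma rcount_multiples:
  assumes "n > 0" "d > 0" "d dvd n"
  shows "int (rcount n {x. d dvd x}) = n div d"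
proof -
  have "residues_of n {x. d dvd x} = (\<lambda>k. d * k) ` {0..<n div d}"
  proof (intro equalityI subsetI)
    fix x assume "x \<in> residues_of n {x. d dvd x}"
    then obtain k where k: "x = d * k" "0 \<le> x" "x < n" by (auto simp: residues_of_def)
    moreover have "n = d * (n div d)" using assms by simp
    ultimately have "d * 0 \<le> d * k" "d * k < d * (n div d)" by auto
    then have "0 \<le> k" "k < n div d" using assms(2) by (simp_all only: mult_le_cancel_left_pos mult_less_cancel_left_pos)
    then show "x \<in> (\<lambda>k. d * k) ` {0..<n div d}" using k(1) by (intro image_eqI[of _ _ k]) auto
  next
    fix x assume "x \<in> (\<lambda>k. d * k) ` {0..<n div d}"
    then obtain k where k: "x = d * k" "0 \<le> k" "k < n div d" using assms(2) by auto
    then have "d * k < d * (n div d)" using assms(2) by simp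
    then show "x \<in> residues_of n {x. d dvd x}" using k assms by (simp add: residues_of_def)
  qed
  moreover have "card ((\<lambda>k. d * k) ` {0..<n div d}) = nat (n div d)"
    using assms(2) by (subst card_image) (auto simp: inj_on_def)
  ultimately show ?thesis using assms by (simp add: rcount_def pos_imp_zdiv_nonneg_iff)
qed

text \<open>Division with remainder by the least positive element of \<open>A\<close>. The subgroups
  of Z/n met later (periods, blocks, displacements, the complement) are first found as sets closed
  under subtraction and become divisors of \<open>n\<close> here.\<close>

lemma int_subgroup_multiples:
  assumes "(n::int) > 0" "n \<in> A" "\<And>x y. x \<in> A \<Longrightarrow> y \<in> A \<Longrightarrow> x - y \<in> A"
  obtains d where "d > 0" "d dvd n" "A = {x. d dvd x}"
proof -
  have zero: "0 \<in> A" using assms(3)[OF assms(2) assms(2)] by simp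
  have neg: "- x \<in> A" if "x \<in> A" for x using assms(3)[OF zero that] by simp
  have add: "x + y \<in> A" if "x \<in> A" "y \<in> A" for x y using assms(3)[OF that(1) neg[OF that(2)]] by simp
  define m where "m = (LEAST k::nat. k > 0 \<and> int k \<in> A)"
  have "nat n > 0 \<and> int (nat n) \<in> A" using assms by simp
  then have m: "m > 0" "int m \<in> A" unfolding m_def by (metis (mono_tags, lifting) LeastI)+
  have min: "m \<le> k" if "k > 0" "int k \<in> A" for k unfolding m_def using that by (simp add: Least_le)
  have natmul: "int k * int m \<in> A" for k :: nat
    by (induction k) (use zero add m in \<open>auto simp: algebra_simps\<close>)
  have mul: "k * int m \<in> A" for k :: int
  proof (cases "k \<ge> 0")
    case True then show ?thesis using natmul[of "nat k"] by simp
  next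
    case False then show ?thesis using neg[OF natmul[of "nat (- k)"]] by simp
  qed
  have "int m dvd x" if "x \<in> A" for x
  proof (rule ccontr)
    assume "\<not> int m dvd x"
    then have "x mod int m \<noteq> 0" by (simp add: dvd_eq_mod_eq_0)
    moreover have "x mod int m \<ge> 0" "x mod int m < int m" using m by auto
    moreover have "x mod int m \<in> A"
      using assms(3)[OF that mul[of "x div int m"]] by (simp add: minus_div_mult_eq_mod)
    ultimately show False using min[of "nat (x mod int m)"] by auto
  qed
  moreover have "x \<in> A" if "int m dvd x" for x using that mul by (metis dvd_div_mult_self)
  ultimately have "A = {x. int m dvd x}" by blast
  then show thesis using that[of "int m"] m assms(2) by auto
qed

lemma div_right_cancel_pos:
  assumes "(n::int) > 0" "a > 0" "b > 0" "a dvd n" "b dvd n" "n div a = n div b"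
  shows "a = b"
proof -
  have eq: "n = a * (n div b)" "n = b * (n div b)"
    using dvd_mult_div_cancel[OF assms(4)] dvd_mult_div_cancel[OF assms(5)] assms(6) by simp_all
  then have "n div b \<noteq> 0" using assms(1) by auto
  moreover have "a * (n div b) = b * (n div b)" using eq by simp
  ultimately show ?thesis by simp
qed

section \<open>Counting walks of prime length\<close>

text \<open>The coefficient at the group element \<open>y\<close> of the image of \<open>F\<close>
  in Z[X]/(X^n - 1), the integral group ring of Z/n. Computing with integer polynomials and summing
  coefficients over a residue class replaces the quotient ring.\<close>

definition ccoeff :: "int \<Rightarrow> int \<Rightarrow> int poly \<Rightarrow> int" where
  "ccoeff n y F = (\<Sum>i | i \<le> degree F \<and> [int i = y] (mod n). coeff F i)"

lemma ccoeff_bound: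
  assumes "degree F \<le> N"
  shows "ccoeff n y F = (\<Sum>i | i \<le> N \<and> [int i = y] (mod n). coeff F i)"
  unfolding ccoeff_def using assms
  by (intro sum.mono_neutral_left) (auto simp: coeff_eq_0 finite_subset[of _ "{..N}"])

lemma ccoeff_add: "ccoeff n y (F + G) = ccoeff n y F + ccoeff n y G"
proof -
  define N where "N = max (degree F) (degree G)"
  have "degree (F + G) \<le> N" unfolding N_def by (rule degree_add_le_max)
  then show ?thesis
    using ccoeff_bound[of "F + G" N n y] ccoeff_bound[of F N n y] ccoeff_bound[of G N n y]
    by (simp add: N_def sum.distrib)
qed

lemma ccoeff_0: "ccoeff n y 0 = 0"
  by (simp add: ccoeff_def)

lemma ccoeff_sum: "ccoeff n y (sum F I) = (\<Sum>i\<in>I. ccoeff n y (F i))"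
  by (induction I rule: infinite_finite_induct) (simp_all add: ccoeff_0 ccoeff_add)

lemma ccoeff_of_nat_mult: "ccoeff n y (of_nat p * F) = int p * ccoeff n y F"
  by (induction p) (simp_all add: ccoeff_0 ccoeff_add algebra_simps)

lemma ccoeff_cong: "[y = z] (mod n) \<Longrightarrow> ccoeff n y F = ccoeff n z F"
  unfolding ccoeff_def by (rule sum.cong) (auto intro: cong_trans cong_sym)

lemma ccoeff_monom: "ccoeff n y (monom 1 i) = (if [int i = y] (mod n) then 1 else 0)"
proof -
  have "ccoeff n y (monom 1 i) = (\<Sum>j | j \<le> i \<and> [int j = y] (mod n). if j = i then 1 else 0)"
    by (subst ccoeff_bound[of _ i]) (auto simp: degree_monom_eq intro: sum.cong)
  also have "\<dots> = (if [int i = y] (mod n) then 1 else 0)"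
    by (subst sum.delta) (auto simp: finite_subset[of _ "{..i}"])
  finally show ?thesis .
qed

lemma ccoeff_monom_mult: "ccoeff n y (monom 1 s * F) = ccoeff n (y - int s) F"
proof -
  define N where "N = degree F"
  have "degree (monom (1::int) s * F) \<le> s + N"
    unfolding N_def by (rule order.trans[OF degree_mult_le]) (simp add: degree_monom_eq)
  then have "ccoeff n y (monom 1 s * F)
      = (\<Sum>i | i \<le> s + N \<and> [int i = y] (mod n). if i < s then 0 else coeff F (i - s))"
    by (subst ccoeff_bound[of _ "s + N"]) (auto simp: coeff_monom_mult intro: sum.cong)
  also have "\<dots> = (\<Sum>i | s \<le> i \<and> i \<le> s + N \<and> [int i = y] (mod n). coeff F (i - s))"
    by (rule sum.mono_neutral_cong_right) (auto simp: finite_subset[of _ "{..s+N}"])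
  also have "\<dots> = (\<Sum>i | i \<le> N \<and> [int i = y - int s] (mod n). coeff F i)"
    by (rule sum.reindex_bij_witness[where i = "\<lambda>i. i + s" and j = "\<lambda>i. i - s"])
       (auto simp: cong_iff_dvd_diff algebra_simps of_nat_diff)
  finally show ?thesis by (simp add: ccoeff_def N_def)
qed

primrec walks :: "int \<Rightarrow> int set \<Rightarrow> nat \<Rightarrow> int \<Rightarrow> int \<Rightarrow> int" where
  "walks n S 0 x y = (if [x = y] (mod n) then 1 else 0)"
| "walks n S (Suc k) x y = (\<Sum>z\<in>residues_of n {z. z - x \<in> S}. walks n S k z y)"

definition gen_poly :: "int \<Rightarrow> int set \<Rightarrow> int poly" where
  "gen_poly n S = (\<Sum>s\<in>residues_of n S. monom 1 (nat s))"

text \<open>A walk of length \<open>k\<close> from \<open>x\<close> to \<open>y\<close> is a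
  \<open>k\<close>-tuple of steps in \<open>S\<close> with sum \<open>y - x\<close>, and these
  tuples are what the \<open>k\<close>-th power of the group ring element
  \<open>gen_poly n S\<close> enumerates.\<close>

lemma walks_eq_ccoeff:
  assumes "n > 0" "periodic n S"
  shows "walks n S k x y = ccoeff n (y - x) (gen_poly n S ^ k)"
proof (induction k arbitrary: x)
  case 0
  have "monom 1 0 = (1 :: int poly)" by simp
  then have "ccoeff n (y - x) 1 = (if [int 0 = y - x] (mod n) then 1 else 0)"
    using ccoeff_monom[of n "y - x" 0] by simp
  moreover have "[int 0 = y - x] (mod n) \<longleftrightarrow> [x = y] (mod n)"
    by (simp add: cong_iff_dvd_diff dvd_diff_commute)
  ultimately show ?case by simp
next
  case (Suc k)
  have "walks n S (Suc k) x y
      = (\<Sum>z\<in>residues_of n {z. z - x \<in> S}. ccoeff n (y - z) (gen_poly n S ^ k))"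
    by (simp add: Suc.IH)
  also have "\<dots> = (\<Sum>s\<in>residues_of n S. ccoeff n (y - x - s) (gen_poly n S ^ k))"
  proof (rule sum.reindex_bij_witness[where i = "\<lambda>s. (x + s) mod n" and j = "\<lambda>z. (z - x) mod n"])
    fix z assume z: "z \<in> residues_of n {z. z - x \<in> S}"
    have "(x + (z - x) mod n) mod n = z mod n" by (simp add: mod_add_right_eq)
    then show "(x + (z - x) mod n) mod n = z" using z by (simp add: residues_of_def)
    show "(z - x) mod n \<in> residues_of n S"
      using z assms by (auto simp: residues_of_def mod_mem_periodic)
    have "[y - x - (z - x) mod n = y - x - (z - x)] (mod n)"
      by (intro cong_diff cong_refl) (simp add: cong_def)
    then show "ccoeff n (y - x - (z - x) mod n) (gen_poly n S ^ k) = ccoeff n (y - z) (gen_poly n S ^ k)"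
      by (subst ccoeff_cong) (auto simp: algebra_simps)
  next
    fix s assume s: "s \<in> residues_of n S"
    have "((x + s) mod n - x) mod n = s mod n" by (simp add: mod_diff_left_eq)
    then show *: "((x + s) mod n - x) mod n = s" using s by (simp add: residues_of_def)
    have "(x + s) mod n - x \<in> S"
      using mod_mem_periodic[OF assms(2), of "(x + s) mod n - x"] * s by (simp add: residues_of_def)
    then show "(x + s) mod n \<in> residues_of n {z. z - x \<in> S}"
      using assms(1) by (simp add: residues_of_def)
  qed
  also have "\<dots> = (\<Sum>s\<in>residues_of n S. ccoeff n (y - x) (monom 1 (nat s) * gen_poly n S ^ k))"
    by (rule sum.cong) (auto simp: ccoeff_monom_mult residues_of_def)
  also have "\<dots> = ccoeff n (y - x) (gen_poly n S ^ Suc k)"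
    by (simp add: gen_poly_def ccoeff_sum[symmetric] sum_distrib_right)
  finally show ?case .
qed

lemma walks_ciso:
  assumes "n > 0" "periodic n S" "periodic n T" "ciso n S T f"
  shows "walks n T k (f x) (f y) = walks n S k x y"
proof (induction k arbitrary: x)
  case 0
  then show ?case using ciso_cong[OF assms(4)] by simp
next
  case (Suc k)
  obtain g where g: "ciso n T S g" "\<And>x. [g (f x) = x] (mod n)" "\<And>y. [f (g y) = y] (mod n)"
    using ciso_inv[OF assms(4,3)] by blast
  have cgw: "walks n T k a z = walks n T k b z" if "[a = b] (mod n)" for a b z
    unfolding walks_eq_ccoeff[OF assms(1,3)] using that
    by (intro ccoeff_cong) (simp add: cong_diff)
  have fm: "[f (a mod n) = f a] (mod n)" and gm: "[g (a mod n) = g a] (mod n)" for a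
    using ciso_cong[OF assms(4), of "a mod n" a] ciso_cong[OF g(1), of "a mod n" a] by (simp_all add: cong_def)
  have "walks n T (Suc k) (f x) (f y)
      = (\<Sum>z\<in>residues_of n {z. z - x \<in> S}. walks n T k (f z) (f y))"
    unfolding walks.simps
  proof (rule sum.reindex_bij_witness[where i = "\<lambda>z. f z mod n" and j = "\<lambda>z. g z mod n"])
    fix z assume z: "z \<in> residues_of n {z. z - f x \<in> T}"
    have fgz: "[f (g z mod n) = z] (mod n)" using fm[of "g z"] g(3)[of z] cong_trans by blast
    then show "f (g z mod n) mod n = z" using z by (simp add: residues_of_def cong_def)
    have "[f (g z mod n) - f x = z - f x] (mod n)" using fgz by (simp add: cong_diff)
    then have "f (g z mod n) - f x \<in> T" using z periodicD[OF assms(3)] by (simp add: residues_of_def)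
    then show "g z mod n \<in> residues_of n {z. z - x \<in> S}"
      using ciso_diff[OF assms(4)] assms(1) by (simp add: residues_of_def)
    show "walks n T k (f (g z mod n)) (f y) = walks n T k z (f y)" using cgw[OF fgz] .
  next
    fix z assume z: "z \<in> residues_of n {z. z - x \<in> S}"
    have "[g (f z mod n) = z] (mod n)" using gm[of "f z"] g(2)[of z] cong_trans by blast
    then show "g (f z mod n) mod n = z" using z by (simp add: residues_of_def cong_def)
    have "[f z mod n - f x = f z - f x] (mod n)" by (simp add: cong_def mod_diff_left_eq)
    moreover have "f z - f x \<in> T" using z ciso_diff[OF assms(4)] by (simp add: residues_of_def)
    ultimately show "f z mod n \<in> residues_of n {z. z - f x \<in> T}"
      using periodicD[OF assms(3)] assms(1) by (simp add: residues_of_def)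
  qed
  also have "\<dots> = walks n S (Suc k) x y" by (simp add: Suc.IH)
  finally show ?case .
qed

section \<open>The Frobenius congruence for integer polynomials\<close>

lemma freshman_int_poly:
  assumes "prime p"
  shows "\<exists>Q :: int poly. (F + G) ^ p = F ^ p + G ^ p + of_nat p * Q"
proof -
  have p0: "0 < p" using assms prime_gt_0_nat by blast
  have "\<exists>c. (p choose k) = p * c" if "k \<in> {1..<p}" for k
    using dvd_choose_prime[of k p] that assms by (auto elim: dvdE)
  then obtain c where c: "\<And>k. k \<in> {1..<p} \<Longrightarrow> (p choose k) = p * c k" by metis
  have "(F + G) ^ p = (\<Sum>k\<le>p. of_nat (p choose k) * F ^ k * G ^ (p - k))" by (rule binomial_ring)
  also have "{..p} = insert 0 (insert p {1..<p})" using p0 by auto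
  also have "(\<Sum>k\<in>\<dots>. of_nat (p choose k) * F ^ k * G ^ (p - k))
      = G ^ p + F ^ p + (\<Sum>k\<in>{1..<p}. of_nat (p choose k) * F ^ k * G ^ (p - k))"
    using p0 by simp
  also have "(\<Sum>k\<in>{1..<p}. of_nat (p choose k) * F ^ k * G ^ (p - k))
      = of_nat p * (\<Sum>k\<in>{1..<p}. of_nat (c k) * F ^ k * G ^ (p - k))"
    unfolding sum_distrib_left by (rule sum.cong) (simp_all add: c algebra_simps)
  finally have "(F + G) ^ p = F ^ p + G ^ p + of_nat p * (\<Sum>k\<in>{1..<p}. of_nat (c k) * F ^ k * G ^ (p - k))"
    by (simp only: add.commute[of "G ^ p"])
  then show ?thesis ..
qed

lemma freshman_sum_int_poly:
  assumes "prime p" "finite I"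
  shows "\<exists>Q :: int poly. (\<Sum>i\<in>I. F i) ^ p = (\<Sum>i\<in>I. F i ^ p) + of_nat p * Q"
  using assms(2)
proof (induction I rule: finite_induct)
  case empty
  have "0 < p" using assms prime_gt_0_nat by blast
  then show ?case by (intro exI[of _ 0]) simp
next
  case (insert i I)
  obtain Q where Q: "(\<Sum>i\<in>I. F i) ^ p = (\<Sum>i\<in>I. F i ^ p) + of_nat p * Q" using insert.IH by blast
  obtain R where R: "(F i + (\<Sum>i\<in>I. F i)) ^ p = F i ^ p + (\<Sum>i\<in>I. F i) ^ p + of_nat p * R"
    using freshman_int_poly[OF assms(1)] by blast
  show ?case using insert.hyps Q R by (intro exI[of _ "Q + R"]) (simp add: algebra_simps)
qed

definition roots :: "int \<Rightarrow> int set \<Rightarrow> nat \<Rightarrow> int \<Rightarrow> int set" where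
  "roots n S p y = {s \<in> S. [int p * s = y] (mod n)}"

lemma periodic_roots: "periodic n S \<Longrightarrow> periodic n (roots n S p y)"
proof -
  assume S: "periodic n S"
  have "b \<in> roots n S p y" if ab: "[a = b] (mod n)" and a: "a \<in> roots n S p y" for a b
  proof -
    have "[int p * b = int p * a] (mod n)" using ab by (simp add: cong_scalar_left cong_sym)
    then show ?thesis using a periodicD[OF S ab] cong_trans unfolding roots_def by blast
  qed
  then show ?thesis unfolding periodic_def by blast
qed

text \<open>Frobenius on the group ring modulo \<open>p\<close>: only the constant \<open>p\<close>-tuples of steps survive.\<close>

lemma walks_prime:
  assumes "n > 0" "periodic n S" "prime p"
  shows "[walks n S p 0 y = int (rcount n (roots n S p y))] (mod int p)"
proof -
  obtain Q where Q: "gen_poly n S ^ p = (\<Sum>s\<in>residues_of n S. monom 1 (nat s) ^ p) + of_nat p * Q"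
    using freshman_sum_int_poly[OF assms(3) finite_residues_of] unfolding gen_poly_def by blast
  have "walks n S p 0 y = (\<Sum>s\<in>residues_of n S. ccoeff n y (monom 1 (nat s) ^ p)) + int p * ccoeff n y Q"
    using walks_eq_ccoeff[OF assms(1,2), of p 0 y] by (simp add: Q ccoeff_add ccoeff_sum ccoeff_of_nat_mult)
  moreover have "(\<Sum>s\<in>residues_of n S. ccoeff n y (monom 1 (nat s) ^ p)) = int (rcount n (roots n S p y))"
  proof -
    have "(\<Sum>s\<in>residues_of n S. ccoeff n y (monom 1 (nat s) ^ p))
        = (\<Sum>s\<in>residues_of n S. if [int p * s = y] (mod n) then 1 else 0)"
      by (rule sum.cong) (auto simp: monom_power ccoeff_monom residues_of_def algebra_simps)
    also have "\<dots> = int (card {s \<in> residues_of n S. [int p * s = y] (mod n)})"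
      by (simp add: sum.If_cases Int_def)
    also have "{s \<in> residues_of n S. [int p * s = y] (mod n)} = residues_of n (roots n S p y)"
      by (auto simp: residues_of_def roots_def)
    finally show ?thesis by (simp add: rcount_def)
  qed
  ultimately show ?thesis by (simp add: cong_iff_dvd_diff)
qed

text \<open>Isomorphisms preserve numbers of walks, and \<open>walks_prime\<close> reads these
  modulo \<open>p\<close> as sizes of fibres of the multiplication by \<open>p\<close>. Only the
  residue modulo \<open>p\<close> is transferred.\<close>

lemma roots_ciso:
  assumes "n > 0" "periodic n S" "periodic n T" "ciso n S T f" "[f 0 = 0] (mod n)" "prime p"
  shows "[int (rcount n (roots n T p (f y))) = int (rcount n (roots n S p y))] (mod int p)"
proof -
  have "walks n T p 0 (f y) = walks n T p (f 0) (f y)"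
    unfolding walks_eq_ccoeff[OF assms(1,3)] using assms(5)
    by (intro ccoeff_cong cong_diff cong_refl) (rule cong_sym)
  also have "\<dots> = walks n S p 0 y" by (rule walks_ciso[OF assms(1-4)])
  finally show ?thesis
    using walks_prime[OF assms(1,2,6), of y] walks_prime[OF assms(1,3,6), of "f y"] cong_sym cong_trans by metis
qed

lemma rcount_eq_0_iff:
  assumes "n > 0" "periodic n A"
  shows "rcount n A = 0 \<longleftrightarrow> A = {}"
proof
  assume "rcount n A = 0"
  then have e: "residues_of n A = {}" by (simp add: rcount_def)
  show "A = {}"
  proof (rule equals0I)
    fix a assume "a \<in> A"
    then have "a mod n \<in> residues_of n A" using assms by (simp add: residues_of_def mod_mem_periodic)
    then show False using e by simp
  qed
qed (simp add: rcount_def residues_of_def)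

lemma rcount_roots_coprime:
  assumes "n > 0" "periodic n S" "coprime (int p) n"
  shows "rcount n (roots n S p y) = (if y \<in> dilate n (int p) S then 1 else 0)"
proof -
  have "card (residues_of n (roots n S p y)) \<le> 1"
  proof (rule card_le_Suc0_iff_eq[THEN iffD2, unfolded One_nat_def[symmetric]])
    show "\<forall>a\<in>residues_of n (roots n S p y). \<forall>b\<in>residues_of n (roots n S p y). a = b"
    proof (intro ballI)
      fix a b assume *: "a \<in> residues_of n (roots n S p y)" "b \<in> residues_of n (roots n S p y)"
      then have "[int p * a = int p * b] (mod n)"
        unfolding residues_of_def roots_def by (blast intro: cong_trans cong_sym)
      then have "[a = b] (mod n)" using assms(3) cong_mult_lcancel by blast
      then show "a = b" using * cong_less_imp_eq_int[of a n b] by (simp add: residues_of_def)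
    qed
  qed simp
  moreover have "roots n S p y = {} \<longleftrightarrow> y \<notin> dilate n (int p) S"
    unfolding roots_def dilate_def using cong_sym_eq[of _ y n] by auto
  moreover have "rcount n (roots n S p y) = 0 \<longleftrightarrow> roots n S p y = {}"
    using rcount_eq_0_iff[OF assms(1) periodic_roots[OF assms(2)]] .
  moreover have "rcount n (roots n S p y) \<le> 1" using \<open>card _ \<le> 1\<close> by (simp add: rcount_def)
  ultimately show ?thesis by auto
qed

lemma ciso_dilate_prime:
  assumes "n > 0" "periodic n S" "periodic n T" "ciso n S T f" "prime p" "coprime (int p) n"
  shows "ciso n (dilate n (int p) S) (dilate n (int p) T) f"
proof (rule cisoI)
  fix x y
  define g where "g z = f (z + x) - f x" for z
  have g: "ciso n S T g" "[g 0 = 0] (mod n)"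
    unfolding g_def using ciso_base[OF assms(4)] by simp_all
  have p2: "p \<ge> 2" using assms(5) prime_ge_2_nat by blast
  have "[int (rcount n (roots n T p (g (y - x)))) = int (rcount n (roots n S p (y - x)))] (mod int p)"
    by (rule roots_ciso[OF assms(1-3) g assms(5)])
  then have "g (y - x) \<in> dilate n (int p) T \<longleftrightarrow> y - x \<in> dilate n (int p) S"
    \<comment> \<open>Both counts are 0 or 1, which a congruence modulo \<open>p\<close> tells apart
      because \<open>p\<close> is at least 2.\<close>
    unfolding rcount_roots_coprime[OF assms(1,2,6)] rcount_roots_coprime[OF assms(1,3,6)]
    using p2 by (auto simp: cong_def split: if_splits)
  then show "f y - f x \<in> dilate n (int p) T \<longleftrightarrow> y - x \<in> dilate n (int p) S" by (simp add: g_def)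
qed (use assms(4) in \<open>auto simp: ciso_def\<close>)

section \<open>Dilations by units\<close>

lemma dilate_1: "periodic n S \<Longrightarrow> dilate n 1 S = S"
  using saturate_periodic[of n S] by (simp add: dilate_def saturate_def)

lemma dilate_dilate: "dilate n u (dilate n v S) = dilate n (u * v) S"
proof (intro equalityI subsetI)
  fix y assume "y \<in> dilate n u (dilate n v S)"
  then obtain x s where "[y = u * x] (mod n)" "[x = v * s] (mod n)" "s \<in> S" by (auto simp: dilate_def)
  moreover from this have "[u * x = u * v * s] (mod n)" by (simp add: cong_scalar_left mult.assoc)
  ultimately show "y \<in> dilate n (u * v) S" unfolding dilate_def using cong_trans by blast
next
  fix y assume "y \<in> dilate n (u * v) S"
  then obtain s where "[y = u * (v * s)] (mod n)" "s \<in> S" by (auto simp: dilate_def mult.assoc)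
  then show "y \<in> dilate n u (dilate n v S)" unfolding dilate_def using cong_refl by blast
qed

lemma ciso_dilate:
  assumes "n > 0" "periodic n S" "periodic n T" "ciso n S T f" "u > 0" "coprime (int u) n"
  shows "ciso n (dilate n (int u) S) (dilate n (int u) T) f"
  using assms(5,6)
proof (induction u rule: less_induct)
  case (less u)
  show ?case
  proof (cases "u = 1")
    case True
    then show ?thesis using assms dilate_1 by simp
  next
    case False
    then obtain p where p: "prime p" "p dvd u" using prime_factor_nat by blast
    then obtain v where v: "u = p * v" by blast
    have "v < u" "v > 0" using v p(1) less.prems(1) prime_gt_1_nat[of p] by auto
    moreover have cop: "coprime (int p) n" "coprime (int v) n"
      using less.prems(2) v by auto
    ultimately have "ciso n (dilate n (int v) S) (dilate n (int v) T) f" using less.IH by blast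
    then have "ciso n (dilate n (int p) (dilate n (int v) S)) (dilate n (int p) (dilate n (int v) T)) f"
      by (rule ciso_dilate_prime[OF assms(1) periodic_dilate periodic_dilate _ p(1) cop(1)])
    then show ?thesis using v by (simp add: dilate_dilate)
  qed
qed

lemma dilate_cong:
  assumes "[u = v] (mod n)"
  shows "dilate n u S = dilate n v S"
proof -
  have "[u * s = v * s] (mod n)" for s using assms by (rule cong_scalar_right)
  then show ?thesis unfolding dilate_def by (blast intro: cong_trans cong_sym)
qed

lemma rcount_dilate:
  assumes "n > 0" "periodic n S" "coprime u n"
  shows "rcount n (dilate n u S) = rcount n S"
proof (rule sym, rule rcount_eq[of n S "dilate n u S" "\<lambda>x. u * x"])
  show "[u * x = u * y] (mod n) \<longleftrightarrow> [x = y] (mod n)" for x y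
    using assms(3) cong_mult_lcancel by blast
  show "u * x \<in> dilate n u S" if "x \<in> S" for x using that unfolding dilate_def using cong_refl by blast
  show "\<exists>x\<in>S. [u * x = y] (mod n)" if "y \<in> dilate n u S" for y
    using that cong_sym unfolding dilate_def by blast
qed (use assms periodic_dilate in auto)

lemma lift_unit:
  assumes "(n::int) > 0" "m dvd n" "coprime u m"
  obtains v where "coprime v n" "[v = u] (mod m)"
proof -
  \<comment> \<open>Each prime divisor of \<open>n\<close> divides exactly one of \<open>u\<close>
    and \<open>m * k\<close>: if it divides \<open>u\<close>, it divides neither \<open>m\<close>
    nor \<open>k\<close>; otherwise it is a factor of \<open>k\<close>.\<close>
  define k where "k = \<Prod>{p. prime p \<and> p dvd n \<and> \<not> p dvd u}"
  have fin: "finite {p. prime p \<and> p dvd n \<and> \<not> p dvd u}"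
    using finite_divisors_int[of n] assms(1) by (auto intro: finite_subset[of _ "{d. d dvd n}"])
  have "coprime (u + m * k) n"
  proof (rule ccontr)
    assume "\<not> coprime (u + m * k) n"
    then have "\<not> is_unit (gcd (u + m * k) n)" "gcd (u + m * k) n \<noteq> 0"
      using assms(1) by (auto simp: coprime_iff_gcd_eq_1 is_unit_gcd)
    then obtain p where "prime p" "p dvd gcd (u + m * k) n"
      using prime_divisor_exists by blast
    then have p: "prime p" "p dvd u + m * k" "p dvd n" by simp_all
    show False
    proof (cases "p dvd u")
      case True
      then have "p dvd m * k" using p(2) by (simp add: dvd_add_right_iff)
      moreover have "\<not> p dvd m" using True assms(3) p(1) by (meson coprime_common_divisor not_prime_unit)
      ultimately have "p dvd k" using p(1) prime_dvd_mult_iff by blast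
      then obtain q where q: "prime q" "q dvd n" "\<not> q dvd u" "p dvd q"
        unfolding k_def using prime_dvd_prod_iff[OF fin p(1), of "\<lambda>x. x"] by auto
      then show False using True p(1) primes_dvd_imp_eq by blast
    next
      case False
      then have "p dvd k" unfolding k_def using p fin by (intro dvd_prodI[of _ p "\<lambda>x. x"]) auto
      then show False using False p(2) by (simp add: dvd_add_left_iff)
    qed
  qed
  moreover have "[u + m * k = u] (mod m)" by (simp add: cong_iff_dvd_diff)
  ultimately show thesis using that by blast
qed

section \<open>Arc-transitive circulants and their block systems\<close>

lemma ciso_saturate:
  assumes "ciso n S T f" "periodic n T" "d dvd n"
    and pres: "\<And>x y. [f x = f y] (mod d) \<longleftrightarrow> [x = y] (mod d)"
  shows "ciso d (saturate d S) (saturate d T) f"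
proof (rule cisoI)
  fix y show "\<exists>x. [f x = y] (mod d)"
    using ciso_surj[OF assms(1), of y] assms(3) cong_dvd_modulus by blast
next
  fix x y
  show "f y - f x \<in> saturate d T \<longleftrightarrow> y - x \<in> saturate d S"
  proof
    assume "f y - f x \<in> saturate d T"
    then obtain t where t: "t \<in> T" "[f y - f x = t] (mod d)" by (auto simp: saturate_def)
    obtain z where z: "[f z = f x + t] (mod n)" using ciso_surj[OF assms(1)] by blast
    have "[f z - f x = t] (mod n)" using z by (simp add: cong_iff_dvd_diff algebra_simps)
    then have "z - x \<in> S" using t(1) periodicD[OF assms(2)] ciso_diff[OF assms(1)] by blast
    moreover have "[f y = f x + t] (mod d)" using t(2) by (simp add: cong_iff_dvd_diff algebra_simps)
    then have "[f y = f z] (mod d)" using cong_dvd_modulus[OF z assms(3)] cong_sym cong_trans by blast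
    then have "[y - x = z - x] (mod d)" using pres by (simp add: cong_diff)
    ultimately show "y - x \<in> saturate d S" unfolding saturate_def by blast
  next
    assume "y - x \<in> saturate d S"
    then obtain s where s: "s \<in> S" "[y - x = s] (mod d)" by (auto simp: saturate_def)
    have "f (x + s) - f x \<in> T" using s(1) ciso_diff[OF assms(1), of "x + s" x] by simp
    moreover have "[y = x + s] (mod d)" using s(2) by (simp add: cong_iff_dvd_diff algebra_simps)
    then have "[f y - f x = f (x + s) - f x] (mod d)" using pres by (simp add: cong_diff)
    ultimately show "f y - f x \<in> saturate d T" unfolding saturate_def by blast
  qed
qed (use pres in auto)

text \<open>A bijection of Z/n that matches two subgroups makes their orders equal, and a subgroup
  of a cyclic group is determined by its order.\<close>

lemma subgroups_match:
  assumes "n > 0" "d > 0" "e > 0" "d dvd n" "e dvd n" "ciso n S T f"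
    and "\<And>x. e dvd f x \<longleftrightarrow> d dvd x"
  shows "d = e"
proof -
  have "rcount n {x. d dvd x} = rcount n {x. e dvd x}"
    using assms by (intro rcount_ciso[of n _ _ S T f] periodic_multiples) auto
  then have "n div d = n div e"
    using rcount_multiples[of n d] rcount_multiples[of n e] assms by simp
  then show ?thesis using div_right_cancel_pos[of n d e] assms by simp
qed

lemma ciso_dilate_int:
  assumes "n > 0" "periodic n S" "periodic n T" "ciso n S T f" "coprime u n"
  shows "ciso n (dilate n u S) (dilate n u T) f"
proof -
  define k where "k = nat (u mod n + n)"
  have k: "k > 0" "int k = u mod n + n" using assms(1) pos_mod_sign[of n u] by (simp_all add: k_def add_nonneg_pos)
  have "[int k = u] (mod n)" using k(2) by (simp add: cong_def)
  moreover from this have "coprime (int k) n" using assms(5) cong_imp_coprime cong_sym by blast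
  ultimately show ?thesis using ciso_dilate[OF assms(1-4) k(1)] dilate_cong by metis
qed

lemma dilate_periodic_divisor:
  assumes "periodic m S" "m dvd n" "coprime v n"
  shows "dilate n v S = dilate m v S"
proof (intro equalityI subsetI)
  fix y assume "y \<in> dilate n v S"
  then show "y \<in> dilate m v S" unfolding dilate_def using cong_dvd_modulus assms(2) by blast
next
  fix y assume "y \<in> dilate m v S"
  then obtain s where s: "s \<in> S" "[y = v * s] (mod m)" by (auto simp: dilate_def)
  \<comment> \<open>The inverse of \<open>v\<close> modulo \<open>n\<close> carries \<open>y\<close>
    back into \<open>S\<close>; a congruence modulo \<open>m\<close> is enough there because
    \<open>S\<close> is \<open>m\<close>-periodic.\<close>
  obtain w where w: "[v * w = 1] (mod n)" using cong_solve_coprime_int[OF assms(3)] by blast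
  have wm: "[v * w = 1] (mod m)" using cong_dvd_modulus[OF w assms(2)] .
  have "[w * y = w * (v * s)] (mod m)" using s(2) by (rule cong_scalar_left)
  also have "w * (v * s) = (v * w) * s" by (simp add: algebra_simps)
  also have "[(v * w) * s = 1 * s] (mod m)" using wm by (rule cong_scalar_right)
  finally have "w * y \<in> S" using s(1) periodicD[OF assms(1)] by simp
  moreover have "[v * w * y = 1 * y] (mod n)" using w by (rule cong_scalar_right)
  then have "[y = v * (w * y)] (mod n)" by (simp add: mult.assoc cong_sym)
  ultimately show "y \<in> dilate n v S" unfolding dilate_def by blast
qed

section \<open>Periods of a connection set\<close>

definition periods :: "int set \<Rightarrow> int set" where
  "periods S = {r. \<forall>x. x + r \<in> S \<longleftrightarrow> x \<in> S}"

lemma periods_diff: "a \<in> periods S \<Longrightarrow> b \<in> periods S \<Longrightarrow> a - b \<in> periods S"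
proof -
  assume *: "a \<in> periods S" "b \<in> periods S"
  have "x + (a - b) \<in> S \<longleftrightarrow> x \<in> S" for x
  proof -
    have "(x - b) + a \<in> S \<longleftrightarrow> x - b \<in> S" "(x - b) + b \<in> S \<longleftrightarrow> x - b \<in> S"
      using * unfolding periods_def by blast+
    moreover have "(x - b) + a = x + (a - b)" "(x - b) + b = x" by simp_all
    ultimately show ?thesis by metis
  qed
  then show ?thesis by (simp add: periods_def)
qed

lemma periods_multiples:
  assumes "n > 0" "periodic n S"
  obtains m where "m > 0" "m dvd n" "periods S = {r. m dvd r}"
proof (rule int_subgroup_multiples[of n "periods S"])
  show "n \<in> periods S"
    unfolding periods_def by (intro CollectI allI periodicD[OF assms(2)]) (simp add: cong_def)
  show "n > 0" by fact
  show "a - b \<in> periods S" if "a \<in> periods S" "b \<in> periods S" for a b using periods_diff that .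
qed (rule that)

lemma periodic_periods: "periods S = {r. m dvd r} \<Longrightarrow> periodic m S"
proof -
  assume r: "periods S = {r. m dvd r}"
  have "y \<in> S" if "[x = y] (mod m)" "x \<in> S" for x y
  proof -
    have "m dvd y - x" using that(1) cong_sym by (simp add: cong_iff_dvd_diff dvd_diff_commute)
    then have "y - x \<in> periods S" using r by simp
    then have "x + (y - x) \<in> S" using that(2) unfolding periods_def by blast
    then show ?thesis by simp
  qed
  then show ?thesis by (simp add: periodic_def)
qed

lemma periodsI:
  assumes "n > 0" "periodic n S" "\<And>s. s \<in> S \<Longrightarrow> s + q \<in> S"
  shows "q \<in> periods S"
proof -
  have k: "s + int k * q \<in> S" if "s \<in> S" for s k
  proof (induction k)
    case (Suc k)
    then show ?case using assms(3)[OF Suc.IH] by (simp add: algebra_simps)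
  qed (use that in simp)
  have "x \<in> S" if "x + q \<in> S" for x
  proof -
    \<comment> \<open>Modulo \<open>n\<close>, subtracting \<open>q\<close> once is adding it
      \<open>n - 1\<close> times.\<close>
    have "x + q + int (nat (n - 1)) * q \<in> S" using k that by blast
    moreover have "x + q + int (nat (n - 1)) * q = x + n * q" using assms(1) by (simp add: algebra_simps)
    moreover have "[x + n * q = x] (mod n)" by (simp add: cong_iff_dvd_diff)
    ultimately show ?thesis using periodicD[OF assms(2)] by metis
  qed
  then show ?thesis unfolding periods_def using assms(3) by blast
qed

text \<open>\<open>z - x \<in> S\<close> says that \<open>x\<close> points to \<open>z\<close>. So
  \<open>x - y\<close> is a period exactly if \<open>x\<close> and \<open>y\<close> have the same
  out-neighbours, and isomorphisms preserve that.\<close>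

lemma periods_ciso:
  assumes "ciso n S T f" "periodic n T"
  shows "f x - f y \<in> periods T \<longleftrightarrow> x - y \<in> periods S"
proof -
  have shift: "a - b \<in> periods U \<longleftrightarrow> (\<forall>z. z - b \<in> U \<longleftrightarrow> z - a \<in> U)" for a b U
  proof
    assume l: "a - b \<in> periods U"
    show "\<forall>z. z - b \<in> U \<longleftrightarrow> z - a \<in> U"
    proof
      fix z
      have "(z - a) + (a - b) \<in> U \<longleftrightarrow> z - a \<in> U" using l unfolding periods_def by blast
      then show "z - b \<in> U \<longleftrightarrow> z - a \<in> U" by simp
    qed
  next
    assume r: "\<forall>z. z - b \<in> U \<longleftrightarrow> z - a \<in> U"
    have "x + (a - b) \<in> U \<longleftrightarrow> x \<in> U" for x using r[rule_format, of "x + a"] by (simp add: algebra_simps)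
    then show "a - b \<in> periods U" by (simp add: periods_def)
  qed
  have "(\<forall>w. w - f y \<in> T \<longleftrightarrow> w - f x \<in> T) \<longleftrightarrow> (\<forall>z. f z - f y \<in> T \<longleftrightarrow> f z - f x \<in> T)"
  proof
    assume r: "\<forall>z. f z - f y \<in> T \<longleftrightarrow> f z - f x \<in> T"
    show "\<forall>w. w - f y \<in> T \<longleftrightarrow> w - f x \<in> T"
    proof
      fix w
      obtain z where z: "[f z = w] (mod n)" using ciso_surj[OF assms(1)] by blast
      have "[f z - a = w - a] (mod n)" for a using z by (simp add: cong_diff)
      then show "w - f y \<in> T \<longleftrightarrow> w - f x \<in> T" using r periodicD[OF assms(2)] by blast
    qed
  qed blast
  then show ?thesis unfolding shift using ciso_diff[OF assms(1)] by simp
qed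

text \<open>\<open>generating\<close> is connectedness: \<open>S\<close> lies in no proper subgroup.
  Since translations are transitive on the vertices, arc-transitivity amounts to the stabiliser of 0
  being transitive on \<open>S\<close>, the out-neighbours of 0.\<close>

locale circulant =
  fixes n :: int and S :: "int set"
  assumes n_pos: "n > 0"
    and per: "periodic n S"
    and generating: "\<And>d. d dvd n \<Longrightarrow> (\<And>s. s \<in> S \<Longrightarrow> d dvd s) \<Longrightarrow> is_unit d"
    and arc_trans: "\<And>s t. s \<in> S \<Longrightarrow> t \<in> S \<Longrightarrow>
      \<exists>f. ciso n S S f \<and> [f 0 = 0] (mod n) \<and> [f s = t] (mod n)"
begin

text \<open>\<open>is_block d\<close>: the cosets of \<open>d\<int>\<close> form a block system of the automorphism group.\<close>

definition is_block :: "int \<Rightarrow> bool" where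
  "is_block d \<longleftrightarrow> d > 0 \<and> d dvd n \<and> (\<forall>f x y. ciso n S S f \<longrightarrow> ([f x = f y] (mod d) \<longleftrightarrow> [x = y] (mod d)))"

lemma is_blockD: "is_block d \<Longrightarrow> ciso n S S f \<Longrightarrow> [f x = f y] (mod d) \<longleftrightarrow> [x = y] (mod d)"
  by (simp add: is_block_def)

lemma is_block_zero:
  assumes "is_block d" "ciso n S S f" "[f 0 = 0] (mod n)"
  shows "d dvd f x \<longleftrightarrow> d dvd x"
proof -
  have "[f 0 = 0] (mod d)" using assms(1,3) cong_dvd_modulus unfolding is_block_def by blast
  then have "[f x = 0] (mod d) \<longleftrightarrow> [f x = f 0] (mod d)" using cong_sym cong_trans by blast
  then show ?thesis using is_blockD[OF assms(1,2), of x 0] by (simp add: cong_0_iff)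
qed

text \<open>Recentring reduces a pair of vertices to a vertex and 0; the converse implication comes
  from applying the first one to the inverse automorphism.\<close>

lemma is_blockI:
  assumes "d > 0" "d dvd n"
    and inv: "\<And>f x. ciso n S S f \<Longrightarrow> f 0 = 0 \<Longrightarrow> d dvd x \<Longrightarrow> d dvd f x"
  shows "is_block d"
proof -
  have one: "[f x = f y] (mod d)" if "ciso n S S f" "[x = y] (mod d)" for f x y
  proof -
    have "d dvd f ((x - y) + y) - f y"
      by (rule inv[OF ciso_base[OF that(1)]]) (use that(2) in \<open>simp_all add: cong_iff_dvd_diff\<close>)
    then show ?thesis by (simp add: cong_iff_dvd_diff)
  qed
  have "[x = y] (mod d)" if f: "ciso n S S f" and *: "[f x = f y] (mod d)" for f x y
  proof -
    obtain g where g: "ciso n S S g" "\<And>x. [g (f x) = x] (mod n)"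
      using ciso_inv[OF f per] by metis
    have "[g (f x) = g (f y)] (mod d)" using one[OF g(1) *] .
    moreover have "[g (f z) = z] (mod d)" for z using g(2) assms(2) cong_dvd_modulus by blast
    ultimately show ?thesis using cong_sym cong_trans by meson
  qed
  then show ?thesis using one assms unfolding is_block_def by blast
qed

lemma is_block_Gcd:
  assumes inv: "\<And>f x. ciso n S S f \<Longrightarrow> f 0 = 0 \<Longrightarrow> x \<in> A \<Longrightarrow> f x \<in> A"
  shows "is_block (Gcd (insert n A))"
proof -
  define d where "d = Gcd (insert n A)"
  have d: "d dvd n" "\<And>x. x \<in> A \<Longrightarrow> d dvd x" unfolding d_def using Gcd_dvd by blast+
  have "d \<noteq> 0" using d(1) n_pos by auto
  moreover have "d \<ge> 0" unfolding d_def by simp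
  ultimately have d0: "d > 0" by simp
  \<comment> \<open>The displacements that every automorphism, at every base point, turns into
    multiples of \<open>d\<close>. They form a subgroup that contains \<open>n\<close> and, by
    invariance, \<open>A\<close>; hence it contains \<open>d\<close>.\<close>
  define D where "D = {w. \<forall>f z. ciso n S S f \<longrightarrow> d dvd f (z + w) - f z}"
  have D_diff: "v - w \<in> D" if "v \<in> D" "w \<in> D" for v w
  proof -
    have "d dvd f (z + (v - w)) - f z" if f: "ciso n S S f" for f z
    proof -
      have "d dvd f ((z - w) + v) - f (z - w)" "d dvd f ((z - w) + w) - f (z - w)"
        using \<open>v \<in> D\<close> \<open>w \<in> D\<close> f unfolding D_def by blast+
      then have "d dvd (f ((z - w) + v) - f (z - w)) - (f ((z - w) + w) - f (z - w))" by (rule dvd_diff)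
      then show ?thesis by (simp add: algebra_simps)
    qed
    then show ?thesis by (simp add: D_def)
  qed
  have nD: "n \<in> D"
    unfolding D_def
  proof (intro CollectI allI impI)
    fix f z assume f: "ciso n S S f"
    have "[f (z + n) = f z] (mod n)" unfolding ciso_cong[OF f] by (simp add: cong_def)
    then show "d dvd f (z + n) - f z" using d(1) by (simp add: cong_iff_dvd_diff dvd_trans)
  qed
  have AD: "A \<subseteq> D"
    unfolding D_def
  proof (intro subsetI CollectI allI impI)
    fix x f z assume "x \<in> A" and f: "ciso n S S f"
    have "f (x + z) - f z \<in> A" using inv[OF ciso_base[OF f, of z] _ \<open>x \<in> A\<close>] by simp
    then show "d dvd f (z + x) - f z" using d(2) by (simp add: add.commute)
  qed
  obtain e where e: "e > 0" "e dvd n" "D = {x. e dvd x}"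
    using int_subgroup_multiples[OF n_pos nD D_diff] by metis
  have "e dvd d" unfolding d_def by (rule Gcd_greatest) (use AD nD e(3) in auto)
  then have "d \<in> D" using e(3) by simp
  have "is_block d"
  proof (rule is_blockI[OF d0 d(1)])
    fix f x assume f: "ciso n S S f" "f 0 = 0" "d dvd x"
    have "x \<in> D" using \<open>e dvd d\<close> f(3) e(3) by (simp add: dvd_trans)
    then have "d dvd f (0 + x) - f 0" unfolding D_def using f(1) by blast
    then show "d dvd f x" using f(2) by simp
  qed
  then show ?thesis by (simp add: d_def)
qed

text \<open>If the block through 0 contains one out-neighbour of 0, arc-transitivity puts all of
  \<open>S\<close> into it, and \<open>S\<close> generates.\<close>

lemma is_block_disjoint:
  assumes "is_block d" "s \<in> S" "d dvd s"
  shows "is_unit d"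
proof (rule generating)
  show "d dvd n" using assms(1) by (simp add: is_block_def)
  fix t assume "t \<in> S"
  then obtain f where f: "ciso n S S f" "[f 0 = 0] (mod n)" "[f s = t] (mod n)"
    using arc_trans assms(2) by blast
  have "d dvd f s" using is_block_zero[OF assms(1) f(1,2)] assms(3) by simp
  moreover have "[f s = t] (mod d)" using f(3) \<open>d dvd n\<close> cong_dvd_modulus by blast
  ultimately show "d dvd t" using cong_dvd_iff by blast
qed

text \<open>The image of the block through \<open>0\<close> is a subgroup of the same order, and a cyclic group has only one.\<close>

lemma is_block_transport:
  assumes "is_block d" "ciso n S T f" "periodic n T"
  shows "[f x = f y] (mod d) \<longleftrightarrow> [x = y] (mod d)"
proof -
  define h where "h z = f (z + y) - f y" for z
  have h: "ciso n S T h" "h 0 = 0" unfolding h_def using ciso_base[OF assms(2)] by simp_all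
  have d: "d > 0" "d dvd n" using assms(1) by (auto simp: is_block_def)
  obtain k where k: "ciso n T S k" "\<And>x. [k (h x) = x] (mod n)" "\<And>y. [h (k y) = y] (mod n)"
    using ciso_inv[OF h(1) assms(3)] by metis
  define D where "D = {w. \<exists>z. d dvd z \<and> [h z = w] (mod n)}"
  have mem: "h z \<in> D \<longleftrightarrow> d dvd z" for z
  proof
    assume "h z \<in> D"
    then obtain z' where z': "d dvd z'" "[h z' = h z] (mod n)" by (auto simp: D_def)
    then have "[z' = z] (mod d)" using ciso_cong[OF h(1)] d(2) cong_dvd_modulus by blast
    then show "d dvd z" using z'(1) cong_dvd_iff by blast
  qed (auto simp: D_def)
  have perD: "periodic n D" unfolding periodic_def D_def using cong_trans by blast
  have "n \<in> D"
    unfolding D_def using h(2) by (intro CollectI exI[of _ 0]) (simp add: cong_iff_dvd_diff)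
  moreover have "v - w \<in> D" if vw: "v \<in> D" "w \<in> D" for v w
  proof -
    obtain a b where ab: "d dvd a" "[h a = v] (mod n)" "d dvd b" "[h b = w] (mod n)"
      using vw unfolding D_def by blast
    \<comment> \<open>A translation of the second circulant pulled back along \<open>h\<close>: an
      automorphism of the first that moves \<open>b\<close> to 0, and so respects the
      blocks.\<close>
    define g where "g z = k (h z + (- h b))" for z
    have g: "ciso n S S g"
      unfolding g_def
      by (rule ciso_comp[OF h(1)], rule ciso_comp[OF ciso_translation k(1)])
    have "[g b = 0] (mod n)" using k(2)[of 0] h(2) by (simp add: g_def)
    then have "[g b = 0] (mod d)" using d(2) cong_dvd_modulus by blast
    moreover have "[g a = g b] (mod d)"
      using is_blockD[OF assms(1) g] ab(1,3) by (simp add: cong_iff_dvd_diff dvd_diff)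
    ultimately have "d dvd g a" using cong_trans cong_0_iff by blast
    moreover have "[h (g a) = v - w] (mod n)"
    proof -
      have "[h (g a) = h a - h b] (mod n)" using k(3)[of "h a - h b"] by (simp add: g_def)
      then show ?thesis using cong_diff[OF ab(2,4)] cong_trans by blast
    qed
    ultimately show ?thesis by (auto simp: D_def)
  qed
  ultimately obtain e where e: "e > 0" "e dvd n" "D = {x. e dvd x}"
    using int_subgroup_multiples[OF n_pos] by metis
  have "d = e" using mem e(3) by (intro subgroups_match[OF n_pos d(1) e(1) d(2) e(2) h(1)]) simp
  then have "d dvd h (x - y) \<longleftrightarrow> d dvd x - y" using mem e(3) by simp
  then show ?thesis by (simp add: h_def cong_iff_dvd_diff)
qed

lemma circulant_saturate:
  assumes "is_block d"
  shows "circulant d (saturate d S)"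
proof
  have d: "d > 0" "d dvd n" using assms by (auto simp: is_block_def)
  show "d > 0" by fact
  show "periodic d (saturate d S)" by (rule periodic_saturate)
  have sub: "s \<in> saturate d S" if "s \<in> S" for s using that unfolding saturate_def using cong_refl by blast
  show "is_unit e" if "e dvd d" "\<And>s. s \<in> saturate d S \<Longrightarrow> e dvd s" for e
    using generating[of e] that sub d(2) dvd_trans by blast
  fix s t assume "s \<in> saturate d S" "t \<in> saturate d S"
  then obtain s' t' where st: "s' \<in> S" "t' \<in> S" "[s = s'] (mod d)" "[t = t'] (mod d)"
    by (auto simp: saturate_def)
  obtain f where f: "ciso n S S f" "[f 0 = 0] (mod n)" "[f s' = t'] (mod n)"
    using arc_trans st by blast
  have "ciso d (saturate d S) (saturate d S) f" using ciso_saturate[OF f(1) per d(2)] is_blockD[OF assms f(1)] by blast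
  moreover have "[f 0 = 0] (mod d)" "[f s' = t'] (mod d)" using f(2,3) d(2) cong_dvd_modulus by blast+
  moreover have "[f s = f s'] (mod d)" using is_blockD[OF assms f(1)] st(3) by blast
  ultimately show "\<exists>f. ciso d (saturate d S) (saturate d S) f \<and> [f 0 = 0] (mod d) \<and> [f s = t] (mod d)"
    using st(4) cong_trans cong_sym by meson
qed

lemma is_block_periods:
  assumes "m > 0" "m dvd n" "periods S = {r. m dvd r}"
  shows "is_block m"
proof (rule is_blockI[OF assms(1,2)])
  fix f x assume "ciso n S S f" "f 0 = 0" "m dvd x"
  then show "m dvd f x" using periods_ciso[of n S S f x 0] per assms(3) by simp
qed

text \<open>Here \<open>S\<close> consists of generators, hence is a coset of the group of units \<open>v\<close> with \<open>v S = S\<close>, and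
  each such \<open>v\<close> fixes \<open>T\<close> as well.\<close>

lemma multiplier_of_units:
  assumes "ciso n S T f" "[f 0 = 0] (mod n)" "periodic n T"
    and is_block_primes: "\<And>p. Factorial_Ring.prime p \<Longrightarrow> p dvd n \<Longrightarrow> is_block p"
  shows "\<exists>u. coprime u n \<and> T = dilate n u S"
proof (cases "S = {}")
  case True
  have "t \<notin> T" for t
  proof
    assume "t \<in> T"
    obtain x where x: "[f x = t] (mod n)" using ciso_surj[OF assms(1)] by blast
    then have "f x \<in> T" using \<open>t \<in> T\<close> periodicD[OF assms(3)] by blast
    then show False using True ciso_mem[OF assms(1,3,2)] by simp
  qed
  then have "T = dilate n 1 S" using True by (auto simp: dilate_def)
  then show ?thesis by (intro exI[of _ 1]) simp
next
  case False
  then obtain s0 where s0: "s0 \<in> S" by blast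
  have unitI: "coprime x n" if "\<And>p. Factorial_Ring.prime p \<Longrightarrow> p dvd n \<Longrightarrow> \<not> p dvd x" for x
  proof (rule ccontr)
    assume "\<not> coprime x n"
    then have "\<not> is_unit (gcd x n)" "gcd x n \<noteq> 0"
      using n_pos by (auto simp: coprime_iff_gcd_eq_1 is_unit_gcd)
    then obtain p where "Factorial_Ring.prime p" "p dvd gcd x n" using prime_divisor_exists by blast
    then show False using that[of p] by simp
  qed
  have S_unit: "coprime s n" if "s \<in> S" for s
    using is_block_disjoint[OF is_block_primes that] not_prime_unit by (intro unitI) blast
  have T_unit: "coprime (f s) n" if "s \<in> S" for s
  proof (rule unitI)
    fix p :: int assume p: "Factorial_Ring.prime p" "p dvd n"
    have "[f s = f 0] (mod p) \<longleftrightarrow> [s = 0] (mod p)" using is_block_transport[OF is_block_primes[OF p] assms(1,3)] .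
    moreover have "[f 0 = 0] (mod p)" using assms(2) p(2) cong_dvd_modulus by blast
    ultimately have "p dvd f s \<longleftrightarrow> p dvd s" using cong_trans cong_sym cong_0_iff by metis
    then show "\<not> p dvd f s" using is_block_disjoint[OF is_block_primes[OF p] that] p(1) not_prime_unit by blast
  qed
  obtain w where w: "[s0 * w = 1] (mod n)" using cong_solve_coprime_int[OF S_unit[OF s0]] by blast
  have w_unit: "coprime w n" using w by (metis cong_imp_coprime cong_sym coprime_1_left coprime_mult_left_iff)
  \<comment> \<open>Forced by the requirement that \<open>u * s0\<close> be \<open>f s0\<close>
    modulo \<open>n\<close>.\<close>
  define u where "u = f s0 * w"
  have u: "coprime u n" unfolding u_def using T_unit[OF s0] w_unit by simp
  have "dilate n u S \<subseteq> T"
  proof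
    fix t assume "t \<in> dilate n u S"
    then obtain s where s: "s \<in> S" "[t = u * s] (mod n)" by (auto simp: dilate_def)
    define v where "v = s * w"
    have v: "coprime v n" unfolding v_def using S_unit[OF s(1)] w_unit by simp
    have "[s * (s0 * w) = s * 1] (mod n)" using w by (rule cong_scalar_left)
    then have vs0: "[s = v * s0] (mod n)" by (simp add: v_def algebra_simps cong_sym)
    \<comment> \<open>Automorphisms of \<open>S\<close> are also automorphisms of the dilate, which
      contains \<open>s\<close> and therefore the whole orbit \<open>S\<close> of
      \<open>s\<close>.\<close>
    have "S \<subseteq> dilate n v S"
    proof
      fix r assume "r \<in> S"
      then obtain a where a: "ciso n S S a" "[a 0 = 0] (mod n)" "[a s = r] (mod n)"
        using arc_trans s(1) by blast
      have "s \<in> dilate n v S" using vs0 s0 by (auto simp: dilate_def)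
      then have "a s \<in> dilate n v S"
        using ciso_mem[OF ciso_dilate_int[OF n_pos per per a(1) v] periodic_dilate a(2)] by blast
      then show "r \<in> dilate n v S" using a(3) periodicD[OF periodic_dilate] by blast
    qed
    then have Sv: "S = dilate n v S"
      using rcount_dilate[OF n_pos per v] by (intro rcount_subset_eq[OF n_pos per periodic_dilate]) simp_all
    \<comment> \<open>Because \<open>v\<close> fixes \<open>S\<close>, the same \<open>f\<close> is
      an isomorphism onto \<open>T\<close> and onto its dilate by \<open>v\<close>; membership in
      either is decided by the preimage.\<close>
    have fv: "ciso n S (dilate n v T) f" using ciso_dilate_int[OF n_pos per assms(3,1) v] Sv by simp
    have "f s0 \<in> T" using s0 ciso_mem[OF assms(1,3,2)] by simp
    then have "v * f s0 \<in> dilate n v T" unfolding dilate_def using cong_refl by blast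
    moreover have "[t = v * f s0] (mod n)" using s(2) by (simp add: u_def v_def algebra_simps)
    ultimately have tv: "t \<in> dilate n v T" using periodicD[OF periodic_dilate] by blast
    obtain x where x: "[f x = t] (mod n)" using ciso_surj[OF assms(1)] by blast
    then have "f x \<in> dilate n v T" using tv periodicD[OF periodic_dilate] by blast
    then have "x \<in> S" using ciso_mem[OF fv periodic_dilate assms(2)] by blast
    then have "f x \<in> T" using ciso_mem[OF assms(1,3,2)] by blast
    then show "t \<in> T" using x periodicD[OF assms(3)] by blast
  qed
  moreover have "rcount n T = rcount n (dilate n u S)"
    using rcount_dilate[OF n_pos per u] rcount_ciso[OF n_pos per assms(3,1)] ciso_mem[OF assms(1,3,2)] by simp
  ultimately have "dilate n u S = T"
    by (intro rcount_subset_eq[OF n_pos periodic_dilate assms(3)]) simp_all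
  then show ?thesis using u by blast
qed

end

section \<open>Local translations\<close>

lemma periodic_coset: "d dvd m \<Longrightarrow> periodic m {x. (d::int) dvd x - a}"
  unfolding periodic_def
proof (intro allI impI)
  fix x y assume "d dvd m" "[x = y] (mod m)" "x \<in> {x. d dvd x - a}"
  then have "[x - a = y - a] (mod d)" "d dvd x - a"
    using cong_dvd_modulus[of x y m d] by (auto simp: cong_diff)
  then show "y \<in> {x. d dvd x - a}" using cong_dvd_iff by blast
qed

lemma rcount_coset:
  assumes "n > 0" "d > 0" "d dvd n"
  shows "int (rcount n {x. d dvd x - y}) = n div d"
proof -
  have per: "periodic n {x. d dvd x - y}" by (rule periodic_coset[OF assms(3)])
  have "rcount n {x. d dvd x} = rcount n {x. d dvd x - y}"
    using assms(1) per periodic_multiples[OF assms(3)]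
    by (intro rcount_ciso[OF _ _ _ ciso_translation[of n "{}" y]]) auto
  then show ?thesis using rcount_multiples[OF assms] by simp
qed

context circulant
begin

definition exceptional :: "nat \<Rightarrow> int set" where
  "exceptional p = {y. \<not> p dvd rcount n (roots n S p y)}"

lemma is_block_exceptional:
  assumes "Factorial_Ring.prime p"
  shows "is_block (Gcd (insert n (exceptional p)))"
proof (rule is_block_Gcd)
  fix f x assume f: "ciso n S S f" "f 0 = 0" and x: "x \<in> exceptional p"
  have "[int (rcount n (roots n S p (f x))) = int (rcount n (roots n S p x))] (mod int p)"
    using f by (intro roots_ciso[OF n_pos per per _ _ assms]) simp_all
  then have "p dvd rcount n (roots n S p (f x)) \<longleftrightarrow> p dvd rcount n (roots n S p x)"
    using cong_dvd_iff by (metis int_dvd_int_iff)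
  then show "f x \<in> exceptional p" using x by (simp add: exceptional_def)
qed

lemma exceptional_dvd:
  assumes "int p dvd n" "y \<in> exceptional p"
  shows "int p dvd y"
proof -
  have "roots n S p y \<noteq> {}"
  proof
    assume "roots n S p y = {}"
    then have "rcount n (roots n S p y) = 0" by (simp add: rcount_def residues_of_def)
    then show False using assms(2) by (simp add: exceptional_def)
  qed
  then obtain s where "[int p * s = y] (mod n)" by (auto simp: roots_def)
  then have "[int p * s = y] (mod int p)" using assms(1) cong_dvd_modulus by blast
  then show ?thesis using cong_dvd_iff[of "int p * s" y "int p"] by simp
qed

text \<open>The fibre over \<open>p * s\<close> is the part of \<open>S\<close> in the class of
  \<open>s\<close> modulo \<open>q\<close>, a coset of the subgroup of order \<open>p\<close>. Its
  size is positive and divisible by \<open>p\<close>, so the whole coset lies in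
  \<open>S\<close>.\<close>

lemma shift_unexceptional:
  assumes "Factorial_Ring.prime p" "n = int p * q" "s \<in> S" "int p * s \<notin> exceptional p"
  shows "s + q \<in> S"
proof -
  define C where "C = {x. q dvd x - s}"
  have p0: "int p > 0" using assms(1) prime_gt_0_nat by simp
  have q: "q > 0" "q dvd n" using n_pos assms(2) p0 by (auto simp: zero_less_mult_iff)
  have eq: "roots n S p (int p * s) = S \<inter> C"
  proof -
    have "[int p * x = int p * s] (mod n) \<longleftrightarrow> q dvd x - s" for x
    proof -
      have "[int p * x = int p * s] (mod n) \<longleftrightarrow> int p * q dvd int p * (x - s)"
        by (simp add: cong_iff_dvd_diff assms(2) right_diff_distrib)
      then show ?thesis using p0 by simp
    qed
    then show ?thesis by (auto simp: roots_def C_def)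
  qed
  have perC: "periodic n C" unfolding C_def by (rule periodic_coset[OF q(2)])
  have perSC: "periodic n (S \<inter> C)" using periodic_roots[OF per, of p "int p * s"] eq by simp
  have "n div q = int p" using assms(2) q(1) by simp
  then have C: "rcount n C = p" using rcount_coset[OF n_pos q, of s] by (simp add: C_def)
  have "s \<in> S \<inter> C" using assms(3) by (simp add: C_def)
  then have "rcount n (S \<inter> C) \<noteq> 0" using rcount_eq_0_iff[OF n_pos perSC] by blast
  moreover have "p dvd rcount n (S \<inter> C)" using assms(4) eq by (simp add: exceptional_def)
  ultimately have "p \<le> rcount n (S \<inter> C)" by (simp add: dvd_imp_le)
  then have "S \<inter> C = C" using C by (intro rcount_subset_eq[OF n_pos perSC perC]) simp_all
  moreover have "s + q \<in> C" by (simp add: C_def)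
  ultimately show ?thesis by blast
qed

text \<open>\<open>B\<close> is a block in the sense of permutation groups, phrased with preimages.
  Translations are among the automorphisms, so moving \<open>b\<close> to 0 turns \<open>B\<close>
  into a subgroup.\<close>

lemma imprimitive_is_block:
  assumes "m dvd n" "m > 0" "periodic m B" "b \<in> B"
    and block: "\<And>f. ciso n S S f \<Longrightarrow> (\<exists>x\<in>B. f x \<in> B) \<Longrightarrow> {x. f x \<in> B} = B"
  obtains d where "is_block d" "d dvd m" "B = {x. d dvd x - b}"
proof -
  define D where "D = {x. x + b \<in> B}"
  have "m \<in> D" using assms(4) periodicD[OF assms(3), of "m + b" b] by (simp add: D_def cong_def)
  moreover have "x - y \<in> D" if "x \<in> D" "y \<in> D" for x y
  proof -
    have "{z. z + (y - x) \<in> B} = B"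
    proof (rule block[OF ciso_translation])
      show "\<exists>z\<in>B. z + (y - x) \<in> B"
        using that by (intro bexI[of _ "x + b"]) (simp_all add: D_def algebra_simps)
    qed
    moreover have "(x - y + b) + (y - x) \<in> B" using assms(4) by simp
    ultimately have "x - y + b \<in> B" by blast
    then show ?thesis by (simp add: D_def)
  qed
  ultimately obtain d where d: "d > 0" "d dvd m" "D = {x. d dvd x}"
    using int_subgroup_multiples[OF assms(2)] by metis
  have B: "x \<in> B \<longleftrightarrow> d dvd x - b" for x
  proof -
    have "x \<in> B \<longleftrightarrow> x - b \<in> D" by (simp add: D_def)
    then show ?thesis by (simp add: d(3))
  qed
  have "is_block d"
  proof (rule is_blockI)
    show "d > 0" "d dvd n" using d assms(1) by (auto intro: dvd_trans)
    fix f x assume f: "ciso n S S f" "f 0 = 0" "d dvd x"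
    have "{z. f (z + (- b)) + b \<in> B} = B"
    proof (rule block[OF ciso_shift[OF f(1)]])
      show "\<exists>z\<in>B. f (z + (- b)) + b \<in> B" using assms(4) f(2) by (intro bexI[of _ b]) simp_all
    qed
    moreover have "x + b \<in> B" using B f(3) by simp
    ultimately have "f ((x + b) + (- b)) + b \<in> B" by blast
    then show "d dvd f x" using B by simp
  qed
  then show thesis using that d(2) B by blast
qed

end

text \<open>Modulo \<open>n\<close>, the numbers \<open>h\<close>, \<open>k\<close>, \<open>q\<close> generate subgroups \<open>H\<close>, \<open>K\<close>, \<open>P\<close>, where \<open>P\<close> has order \<open>p\<close>
  and \<open>H\<close> has index \<open>p\<close> in \<open>K\<close>. By \<open>off_shift\<close>, the part of \<open>S\<close> outside \<open>K\<close> is a union of cosets of \<open>P\<close>.\<close>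

locale fibred = circulant +
  fixes p k h q r :: int
  assumes p: "Factorial_Ring.prime p" and h: "h = p * k" and k: "k > 1" and n_eq: "n = h * r"
    and q: "q = k * r" and is_block_h: "is_block h"
    and off_shift: "\<And>s. s \<in> S \<Longrightarrow> \<not> k dvd s \<Longrightarrow> s + q \<in> S"
    and meets: "\<exists>s\<in>S. k dvd s"
    and periods_trivial: "periods S = {x. n dvd x}"
begin

lemma basic_facts: "p > 1" "h > 1" "r > 0" "q > 0" "n = p * q" "k dvd h" "k dvd q" "k dvd n" "h dvd n" "q dvd n"
proof -
  show p1: "p > 1" using p prime_gt_1_int by blast
  have "p * k > 1 * 1" using p1 k by (intro mult_strict_mono) auto
  then show h1: "h > 1" by (simp add: h)
  show "r > 0" using n_pos n_eq h1 by (simp add: zero_less_mult_iff)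
  then show "q > 0" using k by (simp add: q)
  show "n = p * q" by (simp add: n_eq q h)
  show "k dvd h" "k dvd q" "k dvd n" "h dvd n" "q dvd n" unfolding n_eq q h by simp_all
qed

text \<open>\<open>off_shift\<close> can be iterated: \<open>k\<close> divides \<open>q\<close>, so
  a point outside \<open>K\<close> stays outside. Reducing the multiplier modulo \<open>p\<close>
  also reaches negative multiples, as \<open>p * q = n\<close>.\<close>

lemma off_iff:
  assumes "\<not> k dvd x" "q dvd c"
  shows "x + c \<in> S \<longleftrightarrow> x \<in> S"
proof -
  have up: "y + c \<in> S" if y: "y \<in> S" "\<not> k dvd y" and c: "q dvd c" for y c
  proof -
    obtain j where j: "c = q * j" using c by blast
    have i: "y + q * int i \<in> S" for i
    proof (induction i)
      case (Suc i)
      have "k dvd q * int i" using basic_facts(7) by simp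
      then have "\<not> k dvd y + q * int i" using y(2) by (simp add: dvd_add_left_iff)
      then show ?case using off_shift[OF Suc.IH] by (simp add: algebra_simps)
    qed (use y in simp)
    have "int (nat (j mod p)) = j mod p" using basic_facts(1) by simp
    moreover have "[q * (j mod p) = q * j] (mod n)"
    proof -
      have "[j mod p = j] (mod p)" by (simp add: cong_def)
      then have "q * p dvd q * (j mod p - j)" by (simp add: cong_iff_dvd_diff)
      then show ?thesis by (simp add: cong_iff_dvd_diff basic_facts(5) right_diff_distrib mult.commute)
    qed
    ultimately have "[y + q * int (nat (j mod p)) = y + c] (mod n)" by (simp add: j cong_add)
    then show ?thesis using i periodicD[OF per] by blast
  qed
  have "k dvd c" using assms(2) basic_facts(7) dvd_trans by blast
  then have "\<not> k dvd x + c" using assms(1) by (simp add: dvd_add_left_iff)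
  then show ?thesis using up[of x c] up[of "x + c" "- c"] assms by auto
qed

definition loc :: "int \<Rightarrow> int \<Rightarrow> int \<Rightarrow> int" where
  "loc a c x = (if k dvd x - a then x + c else x)"

text \<open>Two points in one coset of \<open>K\<close> are moved alike, so their difference is
  unchanged. Across cosets the difference lies outside \<open>K\<close> and changes by 0,
  \<open>c\<close> or \<open>- c\<close>, which \<open>off_iff\<close> absorbs.\<close>

lemma loc_ciso:
  assumes "q dvd c"
  shows "ciso n S S (loc a c)"
proof -
  have kc: "k dvd c" using assms basic_facts(7) dvd_trans by blast
  have shift: "k dvd y - x + c \<longleftrightarrow> k dvd y - x" "k dvd y - x - c \<longleftrightarrow> k dvd y - x" for x y
    using kc by (simp_all add: dvd_add_left_iff dvd_diff_left_iff)
  show ?thesis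
  proof (rule cisoI)
    fix x y
    have modk: "[loc a c z = z] (mod k)" for z using kc by (simp add: loc_def cong_iff_dvd_diff)
    show "[loc a c x = loc a c y] (mod n) \<longleftrightarrow> [x = y] (mod n)"
    proof (cases "k dvd x - y")
      case True
      then have "k dvd (x - a) - (y - a)" by simp
      then have "k dvd x - a \<longleftrightarrow> k dvd y - a" using dvd_diff_left_iff dvd_diff_right_iff by metis
      then show ?thesis by (simp add: loc_def cong_iff_dvd_diff)
    next
      case False
      then have "\<not> [x = y] (mod k)" by (simp add: cong_iff_dvd_diff)
      moreover from this have "\<not> [loc a c x = loc a c y] (mod k)"
        using modk cong_sym cong_trans by meson
      ultimately show ?thesis using basic_facts(8) cong_dvd_modulus by blast
    qed
    have diff: "k dvd y - x" if "k dvd x - a" "k dvd y - a" using dvd_diff[OF that(2,1)] by simp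
    show "loc a c y - loc a c x \<in> S \<longleftrightarrow> y - x \<in> S"
    proof (cases "k dvd y - x")
      case True
      then have "k dvd (y - a) - (x - a)" by simp
      then have "k dvd x - a \<longleftrightarrow> k dvd y - a" using dvd_diff_left_iff dvd_diff_right_iff by metis
      then show ?thesis by (simp add: loc_def)
    next
      case False
      have "y - x - c \<in> S \<longleftrightarrow> y - x \<in> S" "y - x + c \<in> S \<longleftrightarrow> y - x \<in> S"
        using off_iff[OF False, of "- c"] off_iff[OF False, of c] assms by simp_all
      moreover have "loc a c y - loc a c x \<in> {y - x, y - x + c, y - x - c}"
        by (auto simp: loc_def)
      ultimately show ?thesis by auto
    qed
  next
    fix y
    have "loc a c (loc a (- c) y) = y"
    proof -
      have "k dvd y - c - a \<longleftrightarrow> k dvd y - a" using shift(2)[of y a] by (simp add: algebra_simps)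
      then show ?thesis by (simp add: loc_def)
    qed
    then show "\<exists>x. [loc a c x = y] (mod n)" by (metis cong_refl)
  qed
qed

lemma loc_fixes: "\<not> k dvd x - a \<Longrightarrow> loc a c x = x"
  by (simp add: loc_def)

lemma exists_off: "\<exists>s\<in>S. \<not> k dvd s"
proof (rule ccontr)
  assume "\<not> ?thesis"
  then have "is_unit k" using generating[OF basic_facts(8)] by blast
  then show False using k by simp
qed

lemma q_notin_periods: "q \<notin> periods S"
proof
  assume "q \<in> periods S"
  then have "n dvd q" using periods_trivial by simp
  then have "n \<le> q" using basic_facts(4) by (rule zdvd_imp_le)
  then show False using basic_facts(1,4,5) by simp
qed

text \<open>The pointwise stabiliser of \<open>H\<close>. As \<open>H\<close> is a block, the
  stabiliser of 0 normalises this group; so do the translations by elements of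
  \<open>H\<close>.\<close>

definition nfix :: "(int \<Rightarrow> int) \<Rightarrow> bool" where
  "nfix g \<longleftrightarrow> ciso n S S g \<and> (\<forall>x. h dvd x \<longrightarrow> [g x = x] (mod n))"

lemma nfixD: "nfix g \<Longrightarrow> ciso n S S g" "nfix g \<Longrightarrow> h dvd x \<Longrightarrow> [g x = x] (mod n)"
  "nfix g \<Longrightarrow> [g 0 = 0] (mod n)"
  unfolding nfix_def by auto

lemma nfix_comp:
  assumes "nfix f" "nfix g"
  shows "nfix (\<lambda>x. g (f x))"
  unfolding nfix_def
proof (intro conjI allI impI)
  show "ciso n S S (\<lambda>x. g (f x))" using ciso_comp assms nfixD(1) by blast
  fix x assume x: "h dvd x"
  have "[g (f x) = g x] (mod n)" using ciso_cong[OF nfixD(1)[OF assms(2)]] nfixD(2)[OF assms(1) x] by blast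
  then show "[g (f x) = x] (mod n)" using nfixD(2)[OF assms(2) x] cong_trans by blast
qed

lemma nfix_inv:
  assumes "nfix f"
  obtains g where "nfix g" "\<And>x. [g (f x) = x] (mod n)" "\<And>y. [f (g y) = y] (mod n)"
proof -
  obtain g where g: "ciso n S S g" "\<And>x. [g (f x) = x] (mod n)" "\<And>y. [f (g y) = y] (mod n)"
    using ciso_inv[OF nfixD(1)[OF assms] per] by metis
  have "[g x = x] (mod n)" if "h dvd x" for x
  proof -
    have "[g (f x) = g x] (mod n)" using ciso_cong[OF g(1)] nfixD(2)[OF assms that] by blast
    then show ?thesis using g(2) cong_trans cong_sym by blast
  qed
  then have "nfix g" using g(1) by (simp add: nfix_def)
  then show thesis using that g by blast
qed

lemma nfix_shift:
  assumes "nfix f" "h dvd a"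
  shows "nfix (\<lambda>x. f (x + a) - a)"
  unfolding nfix_def
proof (intro conjI allI impI)
  show "ciso n S S (\<lambda>x. f (x + a) - a)" using ciso_shift[OF nfixD(1)[OF assms(1)], of a "- a"] by simp
  fix x assume "h dvd x"
  then have "[f (x + a) = x + a] (mod n)" using assms by (intro nfixD(2)) simp_all
  then show "[f (x + a) - a = x] (mod n)" by (simp add: cong_iff_dvd_diff algebra_simps)
qed

lemma nfix_conj:
  assumes "nfix e" "ciso n S S f" "[f 0 = 0] (mod n)" "ciso n S S g"
    and fg: "\<And>y. [f (g y) = y] (mod n)"
  shows "nfix (\<lambda>x. f (e (g x)))"
  unfolding nfix_def
proof (intro conjI allI impI)
  show "ciso n S S (\<lambda>x. f (e (g x)))"
    by (rule ciso_comp[OF assms(4)], rule ciso_comp[OF nfixD(1)[OF assms(1)] assms(2)])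
  fix x assume "h dvd x"
  moreover have "[f (g x) = x] (mod h)" using fg basic_facts(9) cong_dvd_modulus by blast
  ultimately have "h dvd f (g x)" using cong_dvd_iff by blast
  then have "h dvd g x" using is_block_zero[OF is_block_h assms(2,3)] by simp
  then have "[f (e (g x)) = f (g x)] (mod n)" using nfixD(2)[OF assms(1)] ciso_cong[OF assms(2)] by blast
  then show "[f (e (g x)) = x] (mod n)" using fg cong_trans by blast
qed

lemma nfix_loc:
  assumes "\<not> k dvd a" "q dvd c"
  shows "nfix (loc a c)"
  unfolding nfix_def
proof (intro conjI allI impI loc_ciso[OF assms(2)])
  fix x assume "h dvd x"
  then have "k dvd x" using basic_facts(6) dvd_trans by blast
  then have "\<not> k dvd x - a" using assms(1) by (simp add: dvd_diff_right_iff)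
  then show "[loc a c x = x] (mod n)" by (simp add: loc_fixes)
qed

lemma nfix_mem: "nfix g \<Longrightarrow> g x \<in> S \<longleftrightarrow> x \<in> S"
  by (rule ciso_mem[OF nfixD(1) per nfixD(3)])

end

section \<open>Jordan sets\<close>

context fibred
begin

section \<open>Orbits inside single cosets of H\<close>

definition nfixh :: "(int \<Rightarrow> int) \<Rightarrow> bool" where
  "nfixh g \<longleftrightarrow> nfix g \<and> (\<forall>x. [g x = x] (mod h))"

text \<open>Adding \<open>y\<close> gives the orbit of \<open>y\<close> under the automorphisms that
  fix \<open>H\<close> pointwise and every coset of \<open>H\<close> as a set.\<close>

definition displacements :: "int \<Rightarrow> int set" where
  "displacements y = {j. \<exists>g. nfixh g \<and> [g y = y + j] (mod n)}"

lemma nfixh_comp: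
  assumes "nfixh f" "nfixh g"
  shows "nfixh (\<lambda>x. g (f x))"
proof -
  have "[g (f x) = x] (mod h)" for x using assms cong_trans unfolding nfixh_def by blast
  then show ?thesis using nfix_comp assms unfolding nfixh_def by simp
qed

lemma nfixh_inv:
  assumes "nfixh f"
  obtains g where "nfixh g" "\<And>x. [g (f x) = x] (mod n)" "\<And>y. [f (g y) = y] (mod n)"
proof -
  obtain g where g: "nfix g" "\<And>x. [g (f x) = x] (mod n)" "\<And>y. [f (g y) = y] (mod n)"
    using nfix_inv assms unfolding nfixh_def by metis
  have "[g x = x] (mod h)" for x
  proof -
    have "[f (g x) = g x] (mod h)" using assms unfolding nfixh_def by blast
    moreover have "[f (g x) = x] (mod h)" using g(3) basic_facts(9) cong_dvd_modulus by blast
    ultimately show ?thesis using cong_sym cong_trans by blast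
  qed
  then have "nfixh g" using g(1) by (simp add: nfixh_def)
  then show thesis using that g by blast
qed

lemma nfixh_shift:
  assumes "nfixh f" "h dvd a"
  shows "nfixh (\<lambda>x. f (x + a) - a)"
proof -
  have "[f (x + a) - a = x] (mod h)" for x
    using assms(1) cong_diff[of "f (x + a)" "x + a" h a a] unfolding nfixh_def by simp
  then show ?thesis using nfix_shift assms unfolding nfixh_def by simp
qed

lemma nfixh_conj:
  assumes "nfixh e" "ciso n S S f" "[f 0 = 0] (mod n)" "ciso n S S g"
    and fg: "\<And>y. [f (g y) = y] (mod n)"
  shows "nfixh (\<lambda>x. f (e (g x)))"
proof -
  have "[f (e (g x)) = x] (mod h)" for x
  proof -
    have "[e (g x) = g x] (mod h)" using assms(1) unfolding nfixh_def by blast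
    then have "[f (e (g x)) = f (g x)] (mod h)" using is_blockD[OF is_block_h assms(2)] by blast
    moreover have "[f (g x) = x] (mod h)" using fg basic_facts(9) cong_dvd_modulus by blast
    ultimately show ?thesis using cong_trans by blast
  qed
  then show ?thesis using nfix_conj assms unfolding nfixh_def by simp
qed

lemma displacements_multiples:
  obtains e where "e > 0" "e dvd n" "displacements y = {j. e dvd j}"
proof (rule int_subgroup_multiples[OF n_pos])
  have "nfixh (\<lambda>x. x)" unfolding nfixh_def nfix_def using ciso_id by simp
  then show "n \<in> displacements y" unfolding displacements_def by (auto simp: cong_def)
next
  fix i j assume "i \<in> displacements y" "j \<in> displacements y"
  then obtain f g where f: "nfixh f" "[f y = y + i] (mod n)" and g: "nfixh g" "[g y = y + j] (mod n)"
    by (auto simp: displacements_def)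
  have hd: "h dvd i'" if "nfixh f'" "[f' y = y + i'] (mod n)" for f' i'
  proof -
    have "[f' y = y + i'] (mod h)" using that(2) basic_facts(9) cong_dvd_modulus by blast
    moreover have "[f' y = y] (mod h)" using that(1) unfolding nfixh_def by blast
    ultimately have "[y + i' = y] (mod h)" using cong_sym cong_trans by blast
    then show ?thesis by (simp add: cong_iff_dvd_diff)
  qed
  obtain g' where g': "nfixh g'" "\<And>x. [g' (g x) = x] (mod n)" using nfixh_inv[OF g(1)] by metis
  \<comment> \<open>The inverse of \<open>g\<close> conjugated by the translation by
    \<open>j - i\<close>, which is admissible because \<open>j - i\<close> lies in \<open>H\<close>.
    It sends \<open>y + i\<close> to \<open>y - (j - i)\<close>.\<close>
  define w where "w x = g' (x + (j - i)) - (j - i)" for x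
  have w: "nfixh w" unfolding w_def using hd f g g'(1) by (intro nfixh_shift) auto
  have "[w (f y) = w (y + i)] (mod n)" using f(2) ciso_cong[OF nfixD(1)] w unfolding nfixh_def by blast
  moreover have "[w (y + i) = y - (j - i)] (mod n)"
  proof -
    have "[g' (y + j) = g' (g y)] (mod n)"
      using g(2) ciso_cong[OF nfixD(1)] g'(1) cong_sym unfolding nfixh_def by blast
    then have "[g' (y + j) = y] (mod n)" using g'(2) cong_trans by blast
    then show ?thesis unfolding w_def by (simp add: cong_diff)
  qed
  ultimately have "[w (f y) = y + (i - j)] (mod n)" using cong_trans by (simp add: algebra_simps) blast
  then show "i - j \<in> displacements y" unfolding displacements_def using nfixh_comp[OF f(1) w] by blast
qed (use that in blast)

text \<open>Conjugation by \<open>f\<close> carries the orbit of \<open>y\<close> onto that of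
  \<open>f y\<close>, so the two subgroups have equal order and coincide.\<close>

lemma displacements_eq:
  assumes f: "ciso n S S f" "[f 0 = 0] (mod n)"
  shows "displacements (f y) = displacements y"
proof -
  obtain g where g: "ciso n S S g" "\<And>x. [g (f x) = x] (mod n)" "\<And>y. [f (g y) = y] (mod n)"
    using ciso_inv[OF f(1) per] by metis
  have g0: "[g 0 = 0] (mod n)" by (rule zero_cong_inv[OF f(1) g(2,3) f(2)])
  obtain d where d: "d > 0" "d dvd n" "displacements y = {j. d dvd j}" using displacements_multiples by metis
  obtain e where e: "e > 0" "e dvd n" "displacements (f y) = {j. e dvd j}" using displacements_multiples by metis
  define f' where "f' z = f (z + y) - f y" for z
  have f': "ciso n S S f'" unfolding f'_def by (rule ciso_base[OF f(1)])
  have "f' z \<in> displacements (f y) \<longleftrightarrow> z \<in> displacements y" for z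
  proof
    assume "z \<in> displacements y"
    then obtain a where a: "nfixh a" "[a y = y + z] (mod n)" by (auto simp: displacements_def)
    have "[f (a (g (f y))) = f (y + z)] (mod n)"
      using a g(2) ciso_cong[OF f(1)] ciso_cong[OF nfixD(1)] cong_trans unfolding nfixh_def by meson
    then have "[f (a (g (f y))) = f y + f' z] (mod n)" by (simp add: f'_def add.commute)
    then show "f' z \<in> displacements (f y)"
      unfolding displacements_def using nfixh_conj[OF a(1) f g(1,3)] by blast
  next
    assume "f' z \<in> displacements (f y)"
    then obtain a where a: "nfixh a" "[a (f y) = f y + f' z] (mod n)" by (auto simp: displacements_def)
    then have "[a (f y) = f (y + z)] (mod n)" by (simp add: f'_def add.commute)
    then have "[g (a (f y)) = g (f (y + z))] (mod n)" using ciso_cong[OF g(1)] by blast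
    then have "[g (a (f y)) = y + z] (mod n)" using g(2) cong_trans by blast
    then show "z \<in> displacements y"
      unfolding displacements_def using nfixh_conj[OF a(1) g(1) g0 f(1) g(2)] by blast
  qed
  then have "d = e" using d e by (intro subgroups_match[OF n_pos d(1) e(1) d(2) e(2) f']) simp
  then show ?thesis using d e by simp
qed

text \<open>If \<open>P \<subseteq> H\<close>, the orbits of the group \<open>nfixh\<close> on \<open>S\<close> are cosets of subgroups of \<open>H\<close> that all have the
  same order, and the local translations make one of them contain \<open>P\<close>; so \<open>S\<close> would be \<open>P\<close>-periodic.\<close>

lemma h_not_dvd_q: "\<not> h dvd q"
proof
  assume hq: "h dvd q"
  obtain s0 where s0: "s0 \<in> S" "\<not> k dvd s0" using exists_off by blast
  have "[loc s0 q x = x] (mod h)" for x using hq by (simp add: loc_def cong_iff_dvd_diff)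
  then have "nfixh (loc s0 q)" using nfix_loc[OF s0(2)] by (simp add: nfixh_def)
  moreover have "loc s0 q s0 = s0 + q" by (simp add: loc_def)
  ultimately have q0: "q \<in> displacements s0" unfolding displacements_def by (metis (mono_tags, lifting) cong_refl mem_Collect_eq)
  have "s + q \<in> S" if s: "s \<in> S" for s
  proof -
    obtain f where f: "ciso n S S f" "[f 0 = 0] (mod n)" "[f s0 = s] (mod n)"
      using arc_trans s0(1) s by blast
    have "q \<in> displacements (f s0)" using q0 displacements_eq[OF f(1,2)] by simp
    then obtain g where g: "nfixh g" "[g (f s0) = f s0 + q] (mod n)" by (auto simp: displacements_def)
    have "[g (f s0) = s + q] (mod n)" using g(2) cong_add[OF f(3) cong_refl[of q]] cong_trans by blast
    moreover have "f s0 \<in> S" using ciso_mem[OF f(1) per f(2)] s0(1) by simp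
    then have "g (f s0) \<in> S" using nfix_mem g(1) unfolding nfixh_def by blast
    ultimately show ?thesis using periodicD[OF per] by blast
  qed
  then show False using periodsI[OF n_pos per] q_notin_periods by blast
qed

lemma coprime_p_r: "coprime p r"
proof (rule prime_imp_coprime[OF p])
  show "\<not> p dvd r"
  proof
    assume "p dvd r"
    then have "p * k dvd r * k" by (rule mult_dvd_mono) simp
    then show False using h_not_dvd_q by (simp add: h q mult.commute)
  qed
qed

text \<open>Since \<open>r\<close> is invertible modulo \<open>p\<close>, \<open>K = H + P\<close>;
  \<open>c\<close> is the component in \<open>P\<close>.\<close>

lemma split_k: assumes "k dvd x" obtains c where "q dvd c" "h dvd x - c"
proof -
  obtain y where y: "x = k * y" using assms by blast
  obtain w where w: "[r * w = 1] (mod p)"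
    using cong_solve_coprime_int[of r p] coprime_p_r by (auto simp: coprime_commute)
  have "[r * w * y = 1 * y] (mod p)" using w by (rule cong_scalar_right)
  then have "p dvd y - r * w * y" by (simp add: cong_iff_dvd_diff dvd_diff_commute)
  then have "k * p dvd k * (y - r * w * y)" by simp
  then have "h dvd x - q * (w * y)" by (simp add: h q y algebra_simps)
  then show thesis using that[of "q * (w * y)"] by simp
qed

text \<open>A Jordan set for the action on cosets of \<open>H\<close>, with a twist: outside
  \<open>J\<close> points are fixed modulo \<open>n\<close>, while inside \<open>J\<close>
  transitivity is asked modulo \<open>h\<close> only. The stronger fixing is what later makes such
  maps elements of \<open>nfix\<close>.\<close>

definition jordan :: "int set \<Rightarrow> bool" where
  "jordan J \<longleftrightarrow> periodic h J \<and> J \<noteq> {} \<and> (\<forall>x\<in>J. \<forall>y\<in>J. \<exists>g. ciso n S S g \<and>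
     (\<forall>z. z \<notin> J \<longrightarrow> [g z = z] (mod n)) \<and> [g x = y] (mod h))"

lemma jordanD:
  assumes "jordan J" "x \<in> J" "y \<in> J"
  obtains g where "ciso n S S g" "\<And>z. z \<notin> J \<Longrightarrow> [g z = z] (mod n)" "[g x = y] (mod h)"
  using assms unfolding jordan_def by meson

lemma jordan_periodic: "jordan J \<Longrightarrow> periodic h J"
  by (simp add: jordan_def)

text \<open>Local translations by \<open>P\<close> suffice, because \<open>K = H + P\<close> makes
  \<open>P\<close> transitive on the cosets of \<open>H\<close> inside a coset of
  \<open>K\<close>.\<close>

lemma jordan_coset: "jordan {x. k dvd x - a}"
  unfolding jordan_def
proof (intro conjI ballI)
  show "periodic h {x. k dvd x - a}" using periodic_coset basic_facts(6) .
  have "a \<in> {x. k dvd x - a}" by simp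
  then show "{x. k dvd x - a} \<noteq> {}" by blast
  fix x y assume *: "x \<in> {x. k dvd x - a}" "y \<in> {x. k dvd x - a}"
  then have "k dvd (y - a) - (x - a)" using dvd_diff by blast
  then have "k dvd y - x" by simp
  then obtain c where c: "q dvd c" "h dvd (y - x) - c" by (rule split_k)
  have "loc a c x = x + c" using * by (simp add: loc_def)
  then have "[loc a c x = y] (mod h)" using c(2) by (simp add: cong_iff_dvd_diff dvd_diff_commute algebra_simps)
  then show "\<exists>g. ciso n S S g \<and> (\<forall>z. z \<notin> {x. k dvd x - a} \<longrightarrow> [g z = z] (mod n)) \<and> [g x = y] (mod h)"
    using loc_ciso[OF c(1)] loc_fixes by (intro exI[of _ "loc a c"]) simp
qed

lemma jordan_Un:
  assumes J: "jordan I" "jordan J" and w: "w \<in> I" "w \<in> J"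
  shows "jordan (I \<union> J)"
  unfolding jordan_def
proof (intro conjI ballI)
  show "periodic h (I \<union> J)" using J jordan_periodic periodic_Un by blast
  show "I \<union> J \<noteq> {}" using w by blast
  let ?E = "\<lambda>g. ciso n S S g \<and> (\<forall>z. z \<notin> I \<union> J \<longrightarrow> [g z = z] (mod n))"
  have E: "\<exists>g. ?E g \<and> [g x = y] (mod h)" if "x \<in> I \<and> y \<in> I \<or> x \<in> J \<and> y \<in> J" for x y
    using that J unfolding jordan_def by (meson UnI1 UnI2)
  fix x y assume "x \<in> I \<union> J" "y \<in> I \<union> J"
  then obtain f g where f: "?E f" "[f x = w] (mod h)" and g: "?E g" "[g w = y] (mod h)"
    using E[of x w] E[of w y] w by blast
  have "?E (\<lambda>z. g (f z))"
  proof (intro conjI allI impI)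
    show "ciso n S S (\<lambda>z. g (f z))" using f g ciso_comp by blast
    fix z assume "z \<notin> I \<union> J"
    then have "[f z = z] (mod n)" "[g z = z] (mod n)" using f g by blast+
    then show "[g (f z) = z] (mod n)" using g(1) ciso_cong cong_trans by blast
  qed
  moreover have "[g (f x) = g w] (mod h)" using f(2) g(1) is_blockD[OF is_block_h] by blast
  then have "[g (f x) = y] (mod h)" using g(2) cong_trans by blast
  ultimately show "\<exists>g. ciso n S S g \<and> (\<forall>z. z \<notin> I \<union> J \<longrightarrow> [g z = z] (mod n)) \<and> [g x = y] (mod h)"
    by (intro exI[of _ "\<lambda>z. g (f z)"]) blast
qed

lemma periodic_h_ciso:
  assumes "ciso n S S f" "periodic h J"
  shows "periodic h {x. f x \<in> J}"
  unfolding periodic_def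
proof (intro allI impI)
  fix x y assume "[x = y] (mod h)" "x \<in> {x. f x \<in> J}"
  moreover from this have "[f x = f y] (mod h)" using is_blockD[OF is_block_h assms(1)] by blast
  ultimately show "y \<in> {x. f x \<in> J}" using periodicD[OF assms(2)] by blast
qed

lemma ciso_surj_h: "ciso n S S f \<Longrightarrow> \<exists>x. [f x = y] (mod h)"
  using ciso_surj basic_facts(9) cong_dvd_modulus by meson

lemma jordan_vimage:
  assumes f: "ciso n S S f" and J: "jordan J"
  shows "jordan {x. f x \<in> J}"
  unfolding jordan_def
proof (intro conjI ballI)
  show "periodic h {x. f x \<in> J}" using periodic_h_ciso[OF f jordan_periodic[OF J]] .
  obtain z where z: "z \<in> J" using J by (auto simp: jordan_def)
  obtain x where "[f x = z] (mod h)" using ciso_surj_h[OF f] by blast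
  then have "f x \<in> J" using z periodicD[OF jordan_periodic[OF J]] by blast
  then show "{x. f x \<in> J} \<noteq> {}" by blast
  fix x y assume xy: "x \<in> {x. f x \<in> J}" "y \<in> {x. f x \<in> J}"
  then have "f x \<in> J" "f y \<in> J" by auto
  then obtain g where g: "ciso n S S g" "\<And>z. z \<notin> J \<Longrightarrow> [g z = z] (mod n)" "[g (f x) = f y] (mod h)"
    using jordanD[OF J] by metis
  obtain e where e: "ciso n S S e" "\<And>x. [e (f x) = x] (mod n)"
    using ciso_inv[OF f per] by metis
  have "ciso n S S (\<lambda>z. e (g (f z)))"
    by (rule ciso_comp[OF f], rule ciso_comp[OF g(1) e(1)])
  moreover have "[e (g (f z)) = z] (mod n)" if "z \<notin> {x. f x \<in> J}" for z
  proof -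
    have "[e (g (f z)) = e (f z)] (mod n)" using g(2) that ciso_cong[OF e(1)] by blast
    then show ?thesis using e(2) cong_trans by blast
  qed
  moreover have "[e (g (f x)) = y] (mod h)"
  proof -
    have "[e (g (f x)) = e (f y)] (mod h)" using g(3) is_blockD[OF is_block_h e(1)] by blast
    moreover have "[e (f y) = y] (mod h)" using e(2) basic_facts(9) cong_dvd_modulus by blast
    ultimately show ?thesis using cong_trans by blast
  qed
  ultimately show "\<exists>g. ciso n S S g \<and> (\<forall>z. z \<notin> {x. f x \<in> J} \<longrightarrow> [g z = z] (mod n)) \<and> [g x = y] (mod h)"
    by (intro exI[of _ "\<lambda>z. e (g (f z))"]) blast
qed

lemma rcount_vimage:
  assumes f: "ciso n S S f" and J: "periodic h J"
  shows "rcount h {x. f x \<in> J} = rcount h J"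
proof (rule rcount_eq[of h _ _ f])
  show "h > 0" using basic_facts(2) by simp
  show "periodic h {x. f x \<in> J}" using periodic_h_ciso[OF f J] .
  show "[f x = f y] (mod h) \<longleftrightarrow> [x = y] (mod h)" for x y using is_blockD[OF is_block_h f] .
  show "\<exists>x\<in>{x. f x \<in> J}. [f x = y] (mod h)" if "y \<in> J" for y
  proof -
    obtain x where "[f x = y] (mod h)" using ciso_surj_h[OF f] by blast
    then show ?thesis using that periodicD[OF J] by blast
  qed
qed (use J in auto)

lemma maximal_jordan:
  obtains J where "jordan J" "J \<noteq> UNIV" "\<And>I. jordan I \<Longrightarrow> I \<noteq> UNIV \<Longrightarrow> rcount h I \<le> rcount h J"
proof -
  let ?P = "\<lambda>J. jordan J \<and> J \<noteq> UNIV"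
  \<comment> \<open>\<open>K\<close> is a proper Jordan set to start from.\<close>
  have "1 \<notin> {x. k dvd x - 0}" using k by simp
  then have "?P {x. k dvd x - 0}" using jordan_coset[of 0] by blast
  moreover have "\<forall>J. ?P J \<longrightarrow> rcount h J < rcount h UNIV + 1"
    using rcount_mono[of _ UNIV h] by (simp add: le_imp_less_Suc)
  ultimately obtain J where J: "?P J" "\<forall>I. ?P I \<longrightarrow> rcount h I \<le> rcount h J"
    using ex_has_greatest_nat[of ?P _ "rcount h" "rcount h UNIV + 1"] by blast
  then show thesis using that by blast
qed

text \<open>Outside the block the stabiliser of 0 is transitive modulo \<open>h\<close>, so
  \<open>S\<close> meets every coset of \<open>H\<close> there, while it misses the block. If
  \<open>k\<close> did not divide \<open>d\<close>, then shifts by \<open>q\<close>, which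
  \<open>S\<close> tolerates outside \<open>K\<close>, would force \<open>q\<close> and with it all
  of \<open>K = H + P\<close> into the block, although \<open>S\<close> meets \<open>K\<close>. So
  \<open>d\<close> lies between \<open>k\<close> and \<open>p * k\<close>, and \<open>d = k\<close>
  fails because \<open>S\<close> meets \<open>K\<close>.\<close>

lemma h_dvd_if_complement:
  assumes d: "is_block d" "d dvd h" and J: "jordan {x. \<not> d dvd x}"
  shows "d = h"
proof -
  have h0: "h > 0" using basic_facts(2) by simp
  obtain s0 where s0: "s0 \<in> S" "k dvd s0" using meets by blast
  have nd: "\<not> d dvd s" if "s \<in> S" for s
  proof
    assume "d dvd s"
    then have "is_unit d" using is_block_disjoint[OF d(1) that] by blast
    then show False using J unfolding jordan_def by (metis dvd_trans one_dvd Collect_empty_eq)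
  qed
  have hit: "\<exists>s\<in>S. [s = x] (mod h)" if x: "\<not> d dvd x" for x
  proof -
    obtain g where g: "ciso n S S g" "\<And>z. z \<notin> {x. \<not> d dvd x} \<Longrightarrow> [g z = z] (mod n)" "[g s0 = x] (mod h)"
      using jordanD[OF J, of s0 x] x nd[OF s0(1)] by (metis (no_types, lifting) mem_Collect_eq)
    have "[g 0 = 0] (mod n)" using g(2) by simp
    then have "g s0 \<in> S" using ciso_mem[OF g(1) per] s0(1) by blast
    then show ?thesis using g(3) by blast
  qed
  have "k dvd d"
  proof (rule ccontr)
    assume kd: "\<not> k dvd d"
    have "d dvd d + q"
    proof (rule ccontr)
      assume "\<not> d dvd d + q"
      then obtain s where s: "s \<in> S" "[s = d + q] (mod h)" using hit by blast
      have "[s = d + q] (mod k)" using s(2) basic_facts(6) cong_dvd_modulus by blast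
      then have "k dvd s \<longleftrightarrow> k dvd d + q" using cong_dvd_iff by blast
      then have "\<not> k dvd s" using kd basic_facts(7) by (simp add: dvd_add_left_iff)
      then have "s + (- q) \<in> S" using off_iff[of s "- q"] s(1) by simp
      moreover have "[s + (- q) = d] (mod d)"
      proof -
        have "[s + (- q) = (d + q) + (- q)] (mod d)"
          using cong_dvd_modulus[OF s(2) d(2)] by (rule cong_add) simp
        then show ?thesis by simp
      qed
      ultimately show False using nd cong_dvd_iff by (metis dvd_refl)
    qed
    then have "d dvd q" by (simp add: dvd_add_right_iff)
    obtain c where c: "q dvd c" "h dvd s0 - c" using split_k[OF s0(2)] .
    have "d dvd (s0 - c) + c" using c \<open>d dvd q\<close> d(2) dvd_trans by (intro dvd_add) blast+
    then show False using nd[OF s0(1)] by simp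
  qed
  then obtain a where a: "d = k * a" by blast
  have "d > 0" using d(1) by (simp add: is_block_def)
  then have a0: "a > 0" using a k by (simp add: zero_less_mult_iff)
  have "k * a dvd k * p" using d(2) a h by (simp add: mult.commute)
  then have "a dvd p" using k by simp
  then have "a = 1 \<or> a = p" using p a0 by (metis prime_int_iff abs_of_pos zdvd1_eq prime_int_altdef zero_less_abs_iff less_imp_le)
  moreover have "a \<noteq> 1" using nd[OF s0(1)] s0(2) a by auto
  ultimately show "d = h" using a h by (simp add: mult.commute)
qed

text \<open>For a maximal proper Jordan set, the images of the set (or of its complement) are pairwise equal
  or disjoint, hence form a block system.\<close>

lemma jordan_complement: "jordan {x. \<not> h dvd x}"
proof -
  have h0: "h > 0" using basic_facts(2) by simp
  obtain J where J: "jordan J" "J \<noteq> UNIV" and max: "\<And>I. jordan I \<Longrightarrow> I \<noteq> UNIV \<Longrightarrow> rcount h I \<le> rcount h J"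
    using maximal_jordan by metis
  have perJ: "periodic h J" using jordan_periodic[OF J(1)] .
  have same: "I \<subseteq> J" if "jordan I" "w \<in> I" "w \<in> J" "I \<union> J \<noteq> UNIV" for I w
  proof -
    have "jordan (I \<union> J)" using jordan_Un[OF that(1) J(1) that(2,3)] .
    then have "rcount h (I \<union> J) \<le> rcount h J" using max that(4) by blast
    then have "J = I \<union> J"
      using perJ periodic_Un[OF jordan_periodic[OF that(1)] perJ] h0 by (intro rcount_subset_eq[of h]) auto
    then show ?thesis by blast
  qed
  have pre_eq: "{x. f x \<in> J} = J" if f: "ciso n S S f" and sub: "{x. f x \<in> J} \<subseteq> J" for f
    using rcount_vimage[OF f perJ] by (intro rcount_subset_eq[OF h0 periodic_h_ciso[OF f perJ] perJ sub]) simp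
  obtain s0 where s0: "s0 \<in> S" "k dvd s0" using meets by blast
  show ?thesis
  proof (cases "\<exists>f. ciso n S S f \<and> (\<exists>w\<in>J. f w \<in> J) \<and> {x. f x \<in> J} \<union> J = UNIV")
    case True
    then obtain f0 w0 where f0: "ciso n S S f0" "w0 \<in> J" "f0 w0 \<in> J" "{x. f0 x \<in> J} \<union> J = UNIV" by blast
    obtain b where b: "b \<notin> J" using J(2) by blast
    \<comment> \<open>Here \<open>J\<close> is so large that some overlapping preimage covers the
      rest, and the complement of \<open>J\<close> is the block.\<close>
    have block: "{x. f x \<in> - J} = - J" if f: "ciso n S S f" and ex: "\<exists>x\<in>- J. f x \<in> - J" for f
    proof -
      have nU: "{x. f x \<in> J} \<union> J \<noteq> UNIV" using ex by blast
      have "\<exists>w\<in>J. f w \<in> J"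
      proof (rule ccontr)
        \<comment> \<open>The preimage of \<open>J\<close> under \<open>f\<close> then lies in the
          complement of \<open>J\<close>, hence in the preimage under \<open>f0\<close>, and equals
          it by size; but the latter meets \<open>J\<close>.\<close>
        assume no: "\<not> ?thesis"
        then have "{x. f x \<in> J} \<subseteq> {x. f0 x \<in> J}" using f0(4) by blast
        moreover have "rcount h {x. f x \<in> J} = rcount h {x. f0 x \<in> J}"
          using rcount_vimage perJ f f0(1) by simp
        ultimately have "{x. f x \<in> J} = {x. f0 x \<in> J}"
          using periodic_h_ciso perJ f f0(1) by (intro rcount_subset_eq[OF h0]) auto
        then show False using no f0(2,3) by blast
      qed
      then have "{x. f x \<in> J} \<subseteq> J" using same[OF jordan_vimage[OF f J(1)]] nU by blast
      then have "{x. f x \<in> J} = J" by (rule pre_eq[OF f])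
      then show ?thesis by blast
    qed
    have "periodic h (- J)" using perJ unfolding periodic_def using cong_sym by blast
    then obtain d where d: "is_block d" "d dvd h" "- J = {x. d dvd x - b}"
      using imprimitive_is_block[of h "- J" b] basic_facts(9) h0 b block by blast
    have "{x. x + b \<in> J} = {x. \<not> d dvd x}"
    proof -
      have "x + b \<in> J \<longleftrightarrow> \<not> d dvd x" for x using d(3) by (metis (mono_tags, lifting) ComplI ComplD add_diff_cancel_right' mem_Collect_eq)
      then show ?thesis by blast
    qed
    then have "jordan {x. \<not> d dvd x}" using jordan_vimage[OF ciso_translation J(1), of b] by simp
    then show ?thesis using h_dvd_if_complement[OF d(1,2)] by simp
  next
    case False
    have block: "{x. f x \<in> J} = J" if f: "ciso n S S f" and ex: "\<exists>x\<in>J. f x \<in> J" for f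
    proof -
      have "{x. f x \<in> J} \<union> J \<noteq> UNIV" using False f ex by blast
      then have "{x. f x \<in> J} \<subseteq> J" using same[OF jordan_vimage[OF f J(1)]] ex by blast
      then show ?thesis by (rule pre_eq[OF f])
    qed
    obtain b where b: "b \<in> J" using J(1) by (auto simp: jordan_def)
    obtain d where d: "is_block d" "d dvd h" "J = {x. d dvd x - b}"
      using imprimitive_is_block[of h J b] basic_facts(9) h0 b block perJ by blast
    have nu: "\<not> is_unit d"
    proof
      assume "is_unit d"
      then have "d dvd x" for x using dvd_trans one_dvd by blast
      then show False using d(3) J(2) by auto
    qed
    \<comment> \<open>The coset \<open>b + K\<close> and \<open>J\<close> share \<open>b\<close> but
      miss \<open>b + 1\<close>, so by maximality \<open>J\<close> absorbs \<open>b + K\<close>.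
      Then an element of \<open>S\<close> in \<open>K\<close> lies in the block, a
      contradiction.\<close>
    have "b + 1 \<notin> {x. k dvd x - b} \<union> J" using nu k by (simp add: d(3))
    then have "{x. k dvd x - b} \<union> J \<noteq> UNIV" by blast
    moreover have "b \<in> {x. k dvd x - b}" by simp
    ultimately have "{x. k dvd x - b} \<subseteq> J" using same[OF jordan_coset _ b] by blast
    then have "s0 + b \<in> J" using s0(2) by auto
    then have "d dvd s0" by (simp add: d(3))
    then show ?thesis using is_block_disjoint[OF d(1) s0(1)] nu by blast
  qed
qed

lemma nfix_transitive:
  assumes "\<not> h dvd x" "\<not> h dvd y"
  obtains g where "nfix g" "[g x = y] (mod h)"
proof -
  have "x \<in> {x. \<not> h dvd x}" "y \<in> {x. \<not> h dvd x}" using assms by simp_all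
  then obtain g where "ciso n S S g" "\<And>z. z \<notin> {x. \<not> h dvd x} \<Longrightarrow> [g z = z] (mod n)" "[g x = y] (mod h)"
    using jordanD[OF jordan_complement] by metis
  then show thesis using that[of g] by (simp add: nfix_def)
qed

end

section \<open>A complement to the block\<close>

context fibred
begin

definition orb :: "int \<Rightarrow> int set" where
  "orb s = {y. \<exists>g. nfix g \<and> [g s = y] (mod n)}"

lemma nfix_id: "nfix (\<lambda>x. x)"
  unfolding nfix_def using ciso_id by simp

lemma orb_refl: "s \<in> orb s"
  unfolding orb_def using nfix_id by (auto intro: exI[of _ "\<lambda>x. x"])

lemma periodic_orb: "periodic n (orb s)"
  unfolding periodic_def orb_def using cong_trans by blast

lemma orb_nfix:
  assumes "nfix g" "x \<in> orb s"
  shows "g x \<in> orb s"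
proof -
  obtain f where f: "nfix f" "[f s = x] (mod n)" using assms(2) by (auto simp: orb_def)
  have "[g (f s) = g x] (mod n)" using f(2) ciso_cong[OF nfixD(1)[OF assms(1)]] by blast
  then show ?thesis unfolding orb_def using nfix_comp[OF f(1) assms(1)] by blast
qed

lemma orb_sym:
  assumes "x \<in> orb s"
  shows "s \<in> orb x"
proof -
  obtain f where f: "nfix f" "[f s = x] (mod n)" using assms by (auto simp: orb_def)
  obtain g where g: "nfix g" "\<And>x. [g (f x) = x] (mod n)" using nfix_inv[OF f(1)] by metis
  have "[g (f s) = g x] (mod n)" using f(2) ciso_cong[OF nfixD(1)[OF g(1)]] by blast
  then have "[g x = s] (mod n)" using g(2) cong_sym cong_trans by blast
  then show ?thesis unfolding orb_def using g(1) by blast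
qed

lemma orb_trans:
  assumes "x \<in> orb s" "y \<in> orb x"
  shows "y \<in> orb s"
proof -
  obtain f where f: "nfix f" "[f x = y] (mod n)" using assms(2) by (auto simp: orb_def)
  then show ?thesis using orb_nfix[OF f(1) assms(1)] periodicD[OF periodic_orb] by blast
qed

lemma orb_shift:
  assumes "x \<in> orb s" "h dvd a"
  shows "x + a \<in> orb (s + a)"
proof -
  obtain f where f: "nfix f" "[f s = x] (mod n)" using assms(1) by (auto simp: orb_def)
  have "nfix (\<lambda>x. f (x + (- a)) - (- a))" using assms(2) by (intro nfix_shift[OF f(1)]) simp
  moreover have "[f ((s + a) + (- a)) - (- a) = x + a] (mod n)" using f(2) by (simp add: cong_add)
  ultimately show ?thesis unfolding orb_def by blast
qed

lemma orb_subset: "s \<in> S \<Longrightarrow> orb s \<subseteq> S"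
  unfolding orb_def using nfix_mem periodicD[OF per] by blast

lemma S_not_h: "s \<in> S \<Longrightarrow> \<not> h dvd s"
  using is_block_disjoint[OF is_block_h] basic_facts(2) by auto

text \<open>A difference \<open>e\<close> in \<open>H\<close> of two points of one orbit shifts that
  orbit into itself. All orbits in \<open>S\<close> are translates of each other by elements of
  \<open>H\<close>, so \<open>e\<close> is a period of \<open>S\<close>, hence 0 modulo
  \<open>n\<close>.\<close>

lemma orb_unique:
  assumes "s \<in> S" "x \<in> orb s" "y \<in> orb s" "[x = y] (mod h)"
  shows "[x = y] (mod n)"
proof -
  define e where "e = y - x"
  have he: "h dvd e" using assms(4) by (simp add: e_def cong_iff_dvd_diff dvd_diff_commute)
  have shift: "w + e \<in> orb s" if "w \<in> orb s" for w
  proof -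
    have "w \<in> orb x" using orb_trans[OF orb_sym[OF assms(2)] that] .
    then have "w + e \<in> orb y" using orb_shift[OF _ he, of w x] by (simp add: e_def)
    then show ?thesis using orb_trans[OF assms(3)] by blast
  qed
  have "t + e \<in> S" if t: "t \<in> S" for t
  proof -
    obtain g where g: "nfix g" "[g s = t] (mod h)"
      using nfix_transitive[OF S_not_h[OF assms(1)] S_not_h[OF t]] by metis
    define a where "a = t - g s"
    have ha: "h dvd a" using g(2) by (simp add: a_def cong_iff_dvd_diff dvd_diff_commute)
    have gs: "g s \<in> orb s" using orb_nfix[OF g(1) orb_refl] .
    have "t \<in> orb (s + a)" using orb_shift[OF gs ha] by (simp add: a_def)
    moreover have "t + e \<in> orb (s + a)"
      using orb_shift[OF shift[OF gs] ha] by (simp add: a_def algebra_simps)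
    ultimately have "t + e \<in> orb t" using orb_sym orb_trans by blast
    then show ?thesis using orb_subset[OF t] by blast
  qed
  then have "e \<in> periods S" using periodsI[OF n_pos per] by blast
  then have "n dvd e" using periods_trivial by simp
  then show ?thesis by (simp add: e_def cong_iff_dvd_diff dvd_diff_commute)
qed

end

locale fibred_orbit = fibred +
  fixes s0 :: int
  assumes s0: "s0 \<in> S"
begin

text \<open>The point of the orbit of \<open>s0\<close> in the coset \<open>x + H\<close>: for
  \<open>x\<close> outside \<open>H\<close> it exists by \<open>nfix_transitive\<close> and is
  unique modulo \<open>n\<close> by \<open>orb_unique\<close>. On \<open>H\<close> the value is
  arbitrary, since the orbit avoids \<open>H\<close>.\<close>

definition om :: "int \<Rightarrow> int" where
  "om x = (SOME w. w \<in> orb s0 \<and> [w = x] (mod h))"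

lemma om:
  assumes "\<not> h dvd x"
  shows "om x \<in> orb s0" "[om x = x] (mod h)"
proof -
  obtain g where "nfix g" "[g s0 = x] (mod h)" using nfix_transitive[OF S_not_h[OF s0] assms] by metis
  then have "\<exists>w. w \<in> orb s0 \<and> [w = x] (mod h)" using orb_nfix[OF _ orb_refl] by blast
  then have "om x \<in> orb s0 \<and> [om x = x] (mod h)" unfolding om_def by (rule someI_ex)
  then show "om x \<in> orb s0" "[om x = x] (mod h)" by blast+
qed

lemma om_unique:
  assumes "\<not> h dvd x" "w \<in> orb s0" "[w = x] (mod h)"
  shows "[om x = w] (mod n)"
proof -
  have "[om x = w] (mod h)" using om(2)[OF assms(1)] assms(3) cong_sym cong_trans by blast
  then show ?thesis using orb_unique[OF s0 om(1)[OF assms(1)] assms(2)] by blast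
qed

lemma om_cong:
  assumes "\<not> h dvd x" "[x = y] (mod h)"
  shows "[om x = om y] (mod n)"
proof -
  have "\<not> h dvd y" using assms cong_dvd_iff by blast
  then have "[om y = x] (mod h)" using om(2) assms(2) cong_sym cong_trans by meson
  then show ?thesis using om_unique[OF assms(1) om(1)[OF \<open>\<not> h dvd y\<close>]] by blast
qed

lemma om_off:
  assumes "w \<in> orb s0" "\<not> k dvd w" "q dvd c"
  shows "w + c \<in> orb s0"
proof -
  have "loc w c w = w + c" by (simp add: loc_def)
  then show ?thesis using orb_nfix[OF nfix_loc[OF assms(2,3)] assms(1)] by simp
qed

text \<open>Off \<open>H\<close>, shifting by suitable elements of \<open>H\<close> turns both sides
  into points of the orbit of \<open>s0\<close> in the same coset of \<open>H\<close>, where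
  \<open>orb_unique\<close> allows only one.\<close>

lemma nfix_central:
  assumes g: "nfix g" and a: "h dvd a"
  shows "[g (x + a) = g x + a] (mod n)"
proof (cases "h dvd x")
  case True
  then have "[g (x + a) = x + a] (mod n)" "[g x + a = x + a] (mod n)"
    using nfixD(2)[OF g] a by (simp_all add: cong_add)
  then show ?thesis using cong_sym cong_trans by blast
next
  case False
  define b where "b = x - om x"
  have hb: "h dvd b" using om(2)[OF False] by (simp add: b_def cong_iff_dvd_diff dvd_diff_commute)
  have x: "x \<in> orb (s0 + b)" using orb_shift[OF om(1)[OF False] hb] by (simp add: b_def)
  have "g x \<in> orb (s0 + b)" using orb_nfix[OF g x] .
  from orb_shift[OF this, of "- b"] hb have 1: "g x - b \<in> orb s0" by simp
  have hba: "h dvd - (b + a)" using hb a by simp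
  have "x + a \<in> orb (s0 + b + a)" using orb_shift[OF x a] .
  then have "g (x + a) \<in> orb (s0 + b + a)" using orb_nfix[OF g] by blast
  from orb_shift[OF this hba] have 2: "g (x + a) - (b + a) \<in> orb s0" by (simp add: algebra_simps)
  have "[g (x + a) = g x] (mod h)"
    using is_blockD[OF is_block_h nfixD(1)[OF g]] a by (simp add: cong_iff_dvd_diff)
  then have "h dvd (g (x + a) - g x) - a" using a by (simp add: cong_iff_dvd_diff)
  then have "[g (x + a) - (b + a) = g x - b] (mod h)" by (simp add: cong_iff_dvd_diff algebra_simps)
  then have "[g (x + a) - (b + a) = g x - b] (mod n)" by (rule orb_unique[OF s0 2 1])
  then show ?thesis by (simp add: cong_iff_dvd_diff algebra_simps)
qed

text \<open>By \<open>nfix_central\<close>, \<open>g\<close> acts on \<open>y + H\<close> as a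
  translation, which recentring at \<open>y\<close> undoes. Here \<open>y\<close> is arbitrary,
  unlike the shifts in \<open>nfix_shift\<close>.\<close>

lemma nfix_recenter:
  assumes g: "nfix g"
  shows "nfix (\<lambda>x. g (x + y) - g y)"
  unfolding nfix_def
proof (intro conjI allI impI)
  show "ciso n S S (\<lambda>x. g (x + y) - g y)" using ciso_base[OF nfixD(1)[OF g]] .
  fix x assume "h dvd x"
  then have "[g (y + x) = g y + x] (mod n)" using nfix_central[OF g] by blast
  then show "[g (x + y) - g y = x] (mod n)" by (simp add: cong_iff_dvd_diff algebra_simps)
qed

text \<open>\<open>om\<close> is a section of \<open>G \<rightarrow> G/H\<close> away from \<open>H\<close>, and \<open>theta\<close> is its cocycle. It turns out to be constant,
  so that \<open>om\<close> becomes a homomorphism after a shift, and its image a complement \<open>M\<close> of \<open>H\<close>.\<close>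

definition theta :: "int \<Rightarrow> int \<Rightarrow> int" where
  "theta a b = om b - om a - om (b - a)"

lemma theta_cong:
  assumes "\<not> h dvd a" "\<not> h dvd b" "\<not> h dvd b - a" "[a = a'] (mod h)" "[b = b'] (mod h)"
  shows "[theta a b = theta a' b'] (mod n)"
  unfolding theta_def using assms by (intro cong_diff om_cong) auto

text \<open>\<open>g\<close> commutes with \<open>om\<close> because it preserves the orbit.
  Recentring \<open>g\<close> at \<open>om a\<close> keeps \<open>om (b - a)\<close> in the orbit,
  which identifies \<open>om (g b - g a)\<close>; the defect \<open>theta a b\<close> lies in
  \<open>H\<close> and passes through \<open>g\<close> by centrality.\<close>

lemma theta_nfix:
  assumes g: "nfix g" and a: "\<not> h dvd a" and b: "\<not> h dvd b" and ba: "\<not> h dvd b - a"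
  shows "[theta (g a) (g b) = theta a b] (mod n)"
proof -
  have gh: "[g x = g y] (mod h) \<longleftrightarrow> [x = y] (mod h)" for x y using is_blockD[OF is_block_h nfixD(1)[OF g]] .
  have gz: "h dvd g x \<longleftrightarrow> h dvd x" for x using is_block_zero[OF is_block_h nfixD(1)[OF g] nfixD(3)[OF g]] .
  have om_g: "[om (g x) = g (om x)] (mod n)" if "\<not> h dvd x" for x
    using that gz gh om[OF that] orb_nfix[OF g] by (intro om_unique) auto
  have th: "h dvd theta a b"
  proof -
    have "[om b - om a - om (b - a) = b - a - (b - a)] (mod h)" using a b ba by (intro cong_diff om(2))
    then show ?thesis by (simp add: theta_def cong_0_iff)
  qed
  define z where "z = om a + om (b - a)"
  have zb: "[z = b] (mod h)" using cong_add[OF om(2)[OF a] om(2)[OF ba]] by (simp add: z_def)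
  have "g (om (b - a) + om a) - g (om a) \<in> orb s0"
    using orb_nfix[OF nfix_recenter[OF g] om(1)[OF ba]] .
  then have orbz: "g z - g (om a) \<in> orb s0" by (simp add: z_def add.commute)
  have "[g z - g (om a) = g b - g a] (mod h)" using zb om(2)[OF a] gh by (intro cong_diff) blast+
  moreover have "\<not> h dvd g b - g a" using ba gh[of b a] by (simp add: cong_iff_dvd_diff)
  ultimately have 1: "[om (g b - g a) = g z - g (om a)] (mod n)" using om_unique orbz by blast
  have "z + theta a b = om b" by (simp add: z_def theta_def)
  then have 2: "[g (om b) = g z + theta a b] (mod n)" using nfix_central[OF g th, of z] by simp
  have "[om (g b) - om (g a) - om (g b - g a) = (g z + theta a b) - g (om a) - (g z - g (om a))] (mod n)"
    using om_g[OF a] om_g[OF b] 1 2 cong_trans by (intro cong_diff) blast+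
  then show ?thesis by (simp add: theta_def algebra_simps)
qed

text \<open>The local translation by \<open>- c\<close> around \<open>om b\<close> preserves the
  orbit of \<open>s0\<close>, so \<open>om (b - c)\<close> is \<open>om b - c\<close>.\<close>

lemma theta_off:
  assumes c: "q dvd c" "\<not> h dvd c" and b: "\<not> k dvd b"
  shows "[theta c b = c - om c] (mod n)"
proof -
  have kc: "k dvd c" using c(1) basic_facts(7) dvd_trans by blast
  have hb: "\<not> h dvd b" using b basic_facts(6) dvd_trans by blast
  have "\<not> k dvd b - c" using b kc by (simp add: dvd_diff_left_iff)
  then have hbc: "\<not> h dvd b - c" using basic_facts(6) dvd_trans by blast
  have "[om b = b] (mod k)" using om(2)[OF hb] basic_facts(6) cong_dvd_modulus by blast
  then have "\<not> k dvd om b" using b cong_dvd_iff by blast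
  then have "om b + (- c) \<in> orb s0" using om_off[OF om(1)[OF hb], of "- c"] c(1) by simp
  moreover have "[om b + (- c) = b - c] (mod h)" using cong_diff[OF om(2)[OF hb] cong_refl, of c] by simp
  ultimately have "[om (b - c) = om b + (- c)] (mod n)" using om_unique[OF hbc] by blast
  then have "[om b - om c - om (b - c) = om b - om c - (om b + (- c))] (mod n)"
    by (intro cong_diff cong_refl)
  then show ?thesis by (simp add: theta_def)
qed

lemma defect_const:
  assumes c: "q dvd c" "\<not> h dvd c" and d: "q dvd d" "\<not> h dvd d"
  shows "[c - om c = d - om d] (mod n)"
proof -
  have h0: "h > 0" using basic_facts(2) by simp
  obtain g where g: "nfix g" "[g c = d] (mod h)" using nfix_transitive[OF c(2) d(2)] by metis
  have gh: "[g x = g y] (mod h) \<longleftrightarrow> [x = y] (mod h)" for x y using is_blockD[OF is_block_h nfixD(1)[OF g(1)]] .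
  \<comment> \<open>\<open>theta_off\<close> is wanted at \<open>b\<close> and at
    \<open>g b\<close>. If no \<open>b\<close> qualifies, \<open>g\<close> embeds \<open>A\<close>,
    the complement of \<open>K\<close> together with \<open>H\<close>, into \<open>K\<close>.
    Including \<open>H\<close> matters for \<open>k = 2\<close>, where the complement alone has the
    size of \<open>K\<close>.\<close>
  have "\<exists>b. \<not> k dvd b \<and> \<not> k dvd g b"
  proof (rule ccontr)
    assume no: "\<not> ?thesis"
    define A where "A = {x. k dvd x \<longrightarrow> h dvd x}"
    have perA: "periodic h A"
      unfolding periodic_def A_def
      using cong_dvd_iff cong_dvd_modulus[OF _ basic_facts(6)] by blast
    have "rcount h A \<le> rcount h {x. k dvd x - 0}"
    proof (rule rcount_le[OF h0 periodic_coset[OF basic_facts(6)], where f = g])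
      fix x assume "x \<in> A"
      show "g x \<in> {x. k dvd x - 0}"
      proof (cases "k dvd x")
        case True
        then have "[g x = x] (mod n)" using \<open>x \<in> A\<close> nfixD(2)[OF g(1)] by (simp add: A_def)
        then have "[g x = x] (mod k)" using basic_facts(8) cong_dvd_modulus by blast
        then show ?thesis using True cong_dvd_iff by auto
      next
        case False
        then show ?thesis using no by auto
      qed
    qed (use gh in blast)
    also have "\<dots> = rcount h {x. k dvd x - 1}"
      using rcount_coset[OF h0 _ basic_facts(6), of 0] rcount_coset[OF h0 _ basic_facts(6), of 1] k by simp
    finally have le: "rcount h A \<le> rcount h {x. k dvd x - 1}" .
    have "{x. k dvd x - 1} \<subseteq> A"
    proof
      fix x assume "x \<in> {x. k dvd x - 1}"
      then have x1: "k dvd x - 1" by simp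
      have "\<not> k dvd x"
      proof
        assume "k dvd x"
        then have "k dvd x - (x - 1)" using x1 by (rule dvd_diff)
        then show False using k by simp
      qed
      then show "x \<in> A" by (simp add: A_def)
    qed
    then have "{x. k dvd x - 1} = A"
      by (rule rcount_subset_eq[OF h0 periodic_coset[OF basic_facts(6)] perA _ le])
    moreover have "0 \<in> A" by (simp add: A_def)
    ultimately have "k dvd 0 - 1" by blast
    then show False using k by simp
  qed
  then obtain b where b: "\<not> k dvd b" "\<not> k dvd g b" by blast
  have hb: "\<not> h dvd b" using b(1) basic_facts(6) dvd_trans by blast
  have kc: "k dvd c" using c(1) basic_facts(7) dvd_trans by blast
  have "\<not> k dvd b - c" using b(1) kc by (simp add: dvd_diff_left_iff)
  then have hbc: "\<not> h dvd b - c" using basic_facts(6) dvd_trans by blast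
  have "\<not> h dvd g c" using g(2) d(2) cong_dvd_iff by blast
  moreover have "\<not> h dvd g b" using b(2) basic_facts(6) dvd_trans by blast
  moreover have "\<not> h dvd g b - g c" using hbc gh[of b c] by (simp add: cong_iff_dvd_diff)
  ultimately have "[theta (g c) (g b) = theta d (g b)] (mod n)" using g(2) by (intro theta_cong) auto
  moreover have "[theta (g c) (g b) = theta c b] (mod n)" using theta_nfix[OF g(1) c(2) hb hbc] .
  ultimately have "[theta c b = theta d (g b)] (mod n)" using cong_sym cong_trans by blast
  then show ?thesis using theta_off[OF c b(1)] theta_off[OF d b(2)] cong_sym cong_trans by meson
qed

text \<open>The common value of \<open>c - om c\<close> on \<open>P\<close> off \<open>H\<close>,
  and of the cocycle \<open>theta\<close>; adding it makes \<open>om\<close> additive.\<close>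

definition v :: int where "v = q - om q"

lemma h_dvd_v: "h dvd v"
  using om(2)[OF h_not_dvd_q] by (simp add: v_def cong_iff_dvd_diff dvd_diff_commute)

lemma om_q_multiple: "q dvd c \<Longrightarrow> \<not> h dvd c \<Longrightarrow> [om c = c - v] (mod n)"
  using defect_const[of c q] h_not_dvd_q by (simp add: v_def cong_iff_dvd_diff dvd_diff_commute algebra_simps)

text \<open>An element of \<open>nfix\<close> moves \<open>a\<close> to \<open>q\<close> modulo
  \<open>h\<close> without changing \<open>theta\<close>. If \<open>g b\<close> is outside
  \<open>K\<close>, \<open>theta_off\<close> applies; inside \<open>K\<close> it is congruent to
  some \<open>c\<close> in \<open>P\<close>, where \<open>om\<close> is the shift by
  \<open>- v\<close>.\<close>

lemma theta_const:
  assumes a: "\<not> h dvd a" and b: "\<not> h dvd b" and ba: "\<not> h dvd b - a"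
  shows "[theta a b = v] (mod n)"
proof -
  obtain g where g: "nfix g" "[g a = q] (mod h)" using nfix_transitive[OF a h_not_dvd_q] by metis
  have gh: "[g x = g y] (mod h) \<longleftrightarrow> [x = y] (mod h)" for x y using is_blockD[OF is_block_h nfixD(1)[OF g(1)]] .
  have gz: "h dvd g x \<longleftrightarrow> h dvd x" for x using is_block_zero[OF is_block_h nfixD(1)[OF g(1)] nfixD(3)[OF g(1)]] .
  have gba: "\<not> h dvd g b - g a" using ba gh[of b a] by (simp add: cong_iff_dvd_diff)
  have 1: "[theta a b = theta (g a) (g b)] (mod n)" using theta_nfix[OF g(1) a b ba] by (rule cong_sym)
  show ?thesis
  proof (cases "k dvd g b")
    case False
    have "[theta (g a) (g b) = theta q (g b)] (mod n)" using a b gz gba g(2) by (intro theta_cong) auto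
    moreover have "[theta q (g b) = v] (mod n)" using theta_off[OF _ h_not_dvd_q False] by (simp add: v_def)
    ultimately show ?thesis using 1 cong_trans by blast
  next
    case True
    obtain c where c: "q dvd c" "h dvd g b - c" by (rule split_k[OF True])
    have gbc: "[g b = c] (mod h)" using c(2) by (simp add: cong_iff_dvd_diff)
    have hc: "\<not> h dvd c" using gbc b gz cong_dvd_iff by blast
    have "[g b - g a = c - q] (mod h)" using gbc g(2) by (rule cong_diff)
    then have hcq: "\<not> h dvd c - q" using gba cong_dvd_iff by blast
    have "[theta (g a) (g b) = theta q c] (mod n)" using a b gz gba g(2) gbc by (intro theta_cong) auto
    moreover have "[om c - om q - om (c - q) = (c - v) - (q - v) - ((c - q) - v)] (mod n)"
      using c(1) hc hcq h_not_dvd_q by (intro cong_diff om_q_multiple) auto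
    then have "[theta q c = v] (mod n)" by (simp add: theta_def)
    ultimately show ?thesis using 1 cong_trans by blast
  qed
qed

text \<open>The image of \<open>om\<close> shifted by \<open>v\<close>, with 0 supplied by hand as
  the representative of \<open>H\<close>, where \<open>om\<close> carries no information.\<close>

definition M :: "int set" where "M = {y. n dvd y \<or> y - v \<in> orb s0}"

lemma orb_not_h: "w \<in> orb s0 \<Longrightarrow> \<not> h dvd w"
  using S_not_h orb_subset[OF s0] by blast

lemma M_h: "y \<in> M \<Longrightarrow> h dvd y \<Longrightarrow> n dvd y"
  using orb_not_h[of "y - v"] h_dvd_v unfolding M_def by auto

lemma M_iff:
  assumes "\<not> h dvd y"
  shows "y \<in> M \<longleftrightarrow> [y = om y + v] (mod n)"
proof
  assume "y \<in> M"
  moreover have "\<not> n dvd y" using assms basic_facts(9) dvd_trans by blast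
  ultimately have "y - v \<in> orb s0" by (simp add: M_def)
  moreover have "[y - v = y] (mod h)" using h_dvd_v by (simp add: cong_iff_dvd_diff)
  ultimately have "[om y = y - v] (mod n)" using om_unique[OF assms] by blast
  then show "[y = om y + v] (mod n)" by (simp add: cong_iff_dvd_diff dvd_diff_commute algebra_simps)
next
  assume "[y = om y + v] (mod n)"
  then have "[om y = y - v] (mod n)" by (simp add: cong_iff_dvd_diff dvd_diff_commute algebra_simps)
  then show "y \<in> M" using om(1)[OF assms] periodicD[OF periodic_orb] by (auto simp: M_def)
qed

lemma M_add:
  assumes a: "\<not> h dvd a" and b: "\<not> h dvd b" and ba: "\<not> h dvd b - a"
  shows "[om b + v = (om a + v) + (om (b - a) + v)] (mod n)"
  using theta_const[OF assms] by (simp add: theta_def cong_iff_dvd_diff algebra_simps)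

text \<open>\<open>theta_const\<close> says nothing when \<open>a\<close>, \<open>b\<close> or
  \<open>b - a\<close> lies in \<open>H\<close>. A detour through one more coset fills such gaps,
  and the index \<open>h = p * k\<close> leaves room for it.\<close>

lemma third_class:
  obtains b where "\<not> h dvd b" "\<not> h dvd b - z"
proof -
  have "p * k \<ge> 2 * 2" using basic_facts(1) k by (intro mult_mono) auto
  then have h4: "h \<ge> 4" by (simp add: h)
  have 1: "\<not> h dvd 1" using h4 by auto
  have 2: "\<not> h dvd 2" using h4 zdvd_imp_le[of h 2] by auto
  have "\<not> h dvd 1 - z \<or> \<not> h dvd 2 - z"
  proof (rule ccontr)
    assume "\<not> ?thesis"
    then have "h dvd (2 - z) - (1 - z)" using dvd_diff by blast
    then show False using 1 by simp
  qed
  then show thesis using that 1 2 by blast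
qed

lemma M_diff:
  assumes y: "y \<in> M" and z: "z \<in> M"
  shows "y - z \<in> M"
proof -
  have perM: "periodic n M"
    unfolding periodic_def
  proof (intro allI impI)
    fix x y assume xy: "[x = y] (mod n)" and "x \<in> M"
    then consider "n dvd x" | "x - v \<in> orb s0" by (auto simp: M_def)
    then show "y \<in> M"
    proof cases
      case 1
      then show ?thesis using xy cong_dvd_iff by (auto simp: M_def)
    next
      case 2
      have "[x - v = y - v] (mod n)" using xy by (simp add: cong_diff)
      then show ?thesis using 2 periodicD[OF periodic_orb] by (auto simp: M_def)
    qed
  qed
  consider (a) "h dvd z" | (b) "\<not> h dvd z" "h dvd y - z" | (c) "\<not> h dvd z" "\<not> h dvd y - z" "h dvd y"
    | (d) "\<not> h dvd z" "\<not> h dvd y - z" "\<not> h dvd y" by blast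
  then show ?thesis
  proof cases
    case a
    then have "n dvd z" using M_h z by blast
    then have "[y = y - z] (mod n)" by (simp add: cong_iff_dvd_diff)
    then show ?thesis using y periodicD[OF perM] by blast
  next
    case b
    have yz: "[y = z] (mod h)" using b(2) by (simp add: cong_iff_dvd_diff)
    then have hy: "\<not> h dvd y" using b(1) cong_dvd_iff by blast
    have "[om y + v = om z + v] (mod n)" using om_cong[OF hy yz] by (simp add: cong_add)
    then have "[y = z] (mod n)" using y z M_iff hy b(1) cong_sym cong_trans by meson
    then show ?thesis by (simp add: M_def cong_iff_dvd_diff)
  next
    case c
    have ny: "n dvd y" using M_h y c(3) by blast
    \<comment> \<open>This case is closure under negation, out of reach of \<open>M_add\<close>
      because 0 is in \<open>H\<close>. Relating \<open>b\<close> to \<open>z\<close> and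
      \<open>b - z\<close>, then \<open>b - z\<close> to \<open>b\<close> and \<open>- z\<close>,
      cancels the terms at \<open>b\<close>.\<close>
    obtain b where b: "\<not> h dvd b" "\<not> h dvd b - z" by (rule third_class)
    have hz: "\<not> h dvd - z" using c(1) by simp
    have "[om b + v = (om z + v) + (om (b - z) + v)] (mod n)" using M_add[OF c(1) b] .
    moreover have "[om (b - z) + v = (om b + v) + (om (- z) + v)] (mod n)"
      using M_add[of b "b - z"] b hz by simp
    ultimately have "[(om b + v) + (om (b - z) + v) = ((om z + v) + (om (b - z) + v)) + ((om b + v) + (om (- z) + v))] (mod n)"
      by (rule cong_add)
    then have 1: "[- (om z + v) = om (- z) + v] (mod n)" by (simp add: cong_iff_dvd_diff algebra_simps)
    have "[z = om z + v] (mod n)" using z M_iff c(1) by blast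
    then have "[- z = - (om z + v)] (mod n)" using cong_minus_minus_iff by blast
    then have "- z \<in> M" using 1 M_iff[OF hz] cong_trans by blast
    moreover have "[- z = y - z] (mod n)" using ny by (simp add: cong_iff_dvd_diff)
    ultimately show ?thesis using periodicD[OF perM] by blast
  next
    case d
    have "[om y + v = (om z + v) + (om (y - z) + v)] (mod n)" using M_add d by blast
    then have "[(om y + v) - (om z + v) = om (y - z) + v] (mod n)" by (simp add: cong_iff_dvd_diff algebra_simps)
    moreover have "[y - z = (om y + v) - (om z + v)] (mod n)" using y z M_iff d by (intro cong_diff) blast+
    ultimately show ?thesis using M_iff d(2) cong_trans by blast
  qed
qed

lemma complement:
  obtains m where "is_block m" "coprime m h" "n = m * h"
    "\<And>s t. s \<in> S \<Longrightarrow> \<not> h dvd t \<Longrightarrow> [s = t] (mod m) \<Longrightarrow> t \<in> S"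
proof -
  have "n \<in> M" by (simp add: M_def)
  then obtain m where m: "m > 0" "m dvd n" "M = {y. m dvd y}"
    using int_subgroup_multiples[OF n_pos _ M_diff] by metis
  have M_om: "m dvd om x + v" if "\<not> h dvd x" for x
  proof -
    have "om x + v \<in> M" using om(1)[OF that] by (simp add: M_def)
    then show ?thesis using m(3) by simp
  qed
  have mh: "n dvd y" if "m dvd y" "h dvd y" for y using M_h[of y] that m(3) by simp
  have cop: "coprime m h"
  proof (rule coprimeI)
    fix c assume c: "c dvd m" "c dvd h"
    have h1: "\<not> h dvd 1" using basic_facts(2) by simp
    have "c dvd om 1 + v" using M_om[OF h1] c(1) dvd_trans by blast
    moreover have "c dvd om 1 - 1"
      using om(2)[OF h1] c(2) dvd_trans by (simp add: cong_iff_dvd_diff) blast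
    moreover have "c dvd v" using h_dvd_v c(2) dvd_trans by blast
    ultimately have "c dvd (om 1 + v) - (om 1 - 1) - v" using dvd_diff by blast
    then show "is_unit c" by simp
  qed
  have n_mh: "n = m * h"
  proof (rule zdvd_antisym_nonneg)
    show "n dvd m * h" by (rule mh) simp_all
    show "m * h dvd n" using divides_mult[OF m(2) basic_facts(9) cop] .
  qed (use n_pos m(1) basic_facts(2) in simp_all)
  \<comment> \<open>Off \<open>H\<close>, the orbits of \<open>nfix\<close> are translates of
    \<open>M\<close> without 0, so these maps preserve every coset of \<open>M\<close>.\<close>
  have nfix_diff: "m dvd g z - z" if g: "nfix g" for g z
  proof (cases "h dvd z")
    case True
    then have "n dvd g z - z" using nfixD(2)[OF g] by (simp add: cong_iff_dvd_diff)
    then show ?thesis using m(2) dvd_trans by blast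
  next
    case False
    define b where "b = z - om z"
    have hb: "h dvd b" using om(2)[OF False] by (simp add: b_def cong_iff_dvd_diff dvd_diff_commute)
    have "z \<in> orb (s0 + b)" using orb_shift[OF om(1)[OF False] hb] by (simp add: b_def)
    then have "g z \<in> orb (s0 + b)" using orb_nfix[OF g] by blast
    from orb_shift[OF this, of "- b"] hb have "g z - b \<in> orb s0" by simp
    then have "g z - b + v \<in> M" by (simp add: M_def)
    then have "m dvd (g z - b + v) - (om z + v)" using M_om[OF False] m(3) by (intro dvd_diff) auto
    then show ?thesis by (simp add: b_def)
  qed
  have "is_block m"
  proof (rule is_blockI[OF m(1,2)])
    fix f x assume f: "ciso n S S f" "f 0 = 0" and x: "m dvd x"
    show "m dvd f x"
    proof (cases "h dvd x")
      case True
      then have "n dvd x" using mh x by blast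
      then have "[f x = f 0] (mod n)" using ciso_cong[OF f(1), of x 0] by (simp add: cong_0_iff)
      then have "n dvd f x" using f(2) by (simp add: cong_0_iff)
      then show ?thesis using m(2) dvd_trans by blast
    next
      case False
      \<comment> \<open>\<open>y\<close> will be an element of \<open>M\<close> whose coset of
        \<open>H\<close> avoids 0 and \<open>x\<close>. Recentred at \<open>y\<close>, a suitable
        element of \<open>nfix\<close> fixes \<open>y + H\<close> pointwise and takes 0 to
        \<open>x\<close>.\<close>
      obtain b where b: "\<not> h dvd b" "\<not> h dvd b - x" by (rule third_class)
      define y where "y = om b + v"
      have yb: "[y = b] (mod h)" using cong_add[OF om(2)[OF b(1)], of v 0] h_dvd_v by (simp add: y_def cong_0_iff)
      have y: "m dvd y" "\<not> h dvd - y" "\<not> h dvd x - y"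
      proof -
        show "m dvd y" using M_om[OF b(1)] by (simp add: y_def)
        show "\<not> h dvd - y" using b(1) yb cong_dvd_iff by auto
        have "[y - x = b - x] (mod h)" using yb by (simp add: cong_diff)
        then have "\<not> h dvd y - x" using b(2) cong_dvd_iff by blast
        then show "\<not> h dvd x - y" by (simp add: dvd_diff_commute)
      qed
      obtain g where g: "nfix g" "[g (- y) = x - y] (mod h)" using nfix_transitive[OF y(2,3)] by metis
      have "m dvd g (- y) - (x - y)"
      proof -
        have "m dvd (g (- y) - (- y)) - x" using nfix_diff[OF g(1)] x by (rule dvd_diff)
        then show ?thesis by (simp add: algebra_simps)
      qed
      then have gy: "[g (- y) = x - y] (mod n)"
        using mh g(2) by (simp add: cong_iff_dvd_diff)
      obtain e where e: "ciso n S S e" "\<And>x. [e (f x) = x] (mod n)" "\<And>y. [f (e y) = y] (mod n)"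
        using ciso_inv[OF f(1) per] by metis
      \<comment> \<open>That map, conjugated by \<open>f\<close> and recentred at
        \<open>f y\<close>. It is in \<open>nfix\<close> and takes \<open>- f y\<close> to
        \<open>f x - f y\<close>, so \<open>nfix_diff\<close> makes \<open>m\<close> divide
        \<open>f x\<close>.\<close>
      define G where "G z = f (g (e (z + f y) + (- y)) + y) - f y" for z
      have "nfix G"
        unfolding nfix_def
      proof (intro conjI allI impI)
        have "ciso n S S (\<lambda>z. g (z + (- y)) + y)" by (rule ciso_shift[OF nfixD(1)[OF g(1)]])
        then have "ciso n S S (\<lambda>z. f (g (e z + (- y)) + y))"
          using ciso_comp[OF ciso_comp[OF e(1)] f(1)] by blast
        then show "ciso n S S G" unfolding G_def using ciso_shift[where b = "- f y"] by fastforce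
        fix z assume z: "h dvd z"
        define w where "w = e (z + f y)"
        have fw: "[f w = z + f y] (mod n)" unfolding w_def using e(3) .
        then have "[f w = z + f y] (mod h)" using basic_facts(9) cong_dvd_modulus by blast
        moreover have "[z + f y = f y] (mod h)" using z by (simp add: cong_iff_dvd_diff)
        ultimately have "[w = y] (mod h)" using is_blockD[OF is_block_h f(1)] cong_trans by blast
        then have "h dvd w + (- y)" by (simp add: cong_iff_dvd_diff)
        then have "[g (w + (- y)) + y = w + (- y) + y] (mod n)"
          using nfixD(2)[OF g(1)] by (intro cong_add) simp_all
        then have "[f (g (w + (- y)) + y) = f w] (mod n)" using ciso_cong[OF f(1)] by simp
        then have "[f (g (w + (- y)) + y) = z + f y] (mod n)" using fw cong_trans by blast
        then show "[G z = z] (mod n)" by (simp add: G_def w_def cong_iff_dvd_diff algebra_simps)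
      qed
      then have 1: "m dvd G (- f y) - (- f y)" by (rule nfix_diff)
      have "[e 0 = 0] (mod n)" using e(2)[of 0] f(2) by simp
      then have "[e 0 + (- y) = - y] (mod n)" using cong_add[of "e 0" 0 n "- y" "- y"] by simp
      then have "[g (e 0 + (- y)) = g (- y)] (mod n)" using ciso_cong[OF nfixD(1)[OF g(1)]] by blast
      then have "[g (e 0 + (- y)) = x - y] (mod n)" using gy cong_trans by blast
      then have "[g (e 0 + (- y)) + y = x] (mod n)" by (simp add: cong_iff_dvd_diff algebra_simps)
      then have "[f (g (e 0 + (- y)) + y) = f x] (mod n)" using ciso_cong[OF f(1)] by blast
      then have "n dvd G (- f y) - (- f y) - f x" by (simp add: G_def cong_iff_dvd_diff)
      then have "m dvd G (- f y) - (- f y) - f x" using m(2) dvd_trans by blast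
      then show ?thesis using 1 by (simp add: dvd_diff_right_iff)
    qed
  qed
  \<comment> \<open>Off \<open>H\<close>, points congruent modulo \<open>m\<close> lie in one orbit
    of \<open>nfix\<close>, and orbits of points of \<open>S\<close> stay in
    \<open>S\<close>.\<close>
  moreover have "t \<in> S" if s: "s \<in> S" and t: "\<not> h dvd t" and st: "[s = t] (mod m)" for s t
  proof -
    have hs: "\<not> h dvd s" using S_not_h[OF s] .
    define a where "a = s - om s"
    have ha: "h dvd a" using om(2)[OF hs] by (simp add: a_def cong_iff_dvd_diff dvd_diff_commute)
    have "m dvd s - t" using st by (simp add: cong_iff_dvd_diff)
    with M_om[OF hs] have "m dvd (om s + v) - (s - t)" by (rule dvd_diff)
    then have "(om s + v) - (s - t) \<in> M" using m(3) by simp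
    moreover have "(om s + v) - (s - t) = t - a + v" by (simp add: a_def)
    moreover have "\<not> h dvd t - a + v" using t ha h_dvd_v by (simp add: dvd_add_left_iff dvd_diff_left_iff)
    then have "\<not> n dvd t - a + v" using basic_facts(9) dvd_trans by blast
    ultimately have "t - a \<in> orb s0" by (simp add: M_def)
    from orb_shift[OF this ha] have "t \<in> orb (s0 + a)" by simp
    moreover have "s \<in> orb (s0 + a)" using orb_shift[OF om(1)[OF hs] ha] by (simp add: a_def)
    ultimately have "t \<in> orb s" using orb_sym orb_trans by blast
    then show ?thesis using orb_subset[OF s] by blast
  qed
  ultimately show thesis using that cop n_mh by blast
qed

end

section \<open>Isomorphic arc-transitive circulants\<close>

theorem circulant_multiplier:
  assumes "circulant n S" "periodic n T" "ciso n S T f"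
  shows "\<exists>u. coprime u n \<and> T = dilate n u S"
  using assms
proof (induction "nat n" arbitrary: n S T f rule: less_induct)
  case less
  interpret circulant n S by (rule less.prems(1))
  have IH: "\<exists>u. coprime u m \<and> T' = dilate m u S'"
    if "m < n" "circulant m S'" "periodic m T'" "ciso m S' T' f'" for m S' T' f'
  proof -
    have "m > 0" using that(2) by (simp add: circulant_def)
    then show ?thesis using that by (intro less.hyps[of m S' T' f']) simp_all
  qed
  define f0 where "f0 x = f (x + 0) - f 0" for x
  have f: "ciso n S T f0" "f0 0 = 0" unfolding f0_def using ciso_base[OF less.prems(3), of 0] by simp_all
  have perT: "periodic n T" by (rule less.prems(2))
  obtain m where m: "m > 0" "m dvd n" "periods S = {r. m dvd r}" by (rule periods_multiples[OF n_pos per])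
  show ?case
  proof (cases "m = n")
    case False
    then have mn: "m < n" using zdvd_imp_le[OF m(2) n_pos] by simp
    have is_block_m: "is_block m" using is_block_periods[OF m] .
    have pres: "[f0 x = f0 y] (mod m) \<longleftrightarrow> [x = y] (mod m)" for x y using is_block_transport[OF is_block_m f(1) perT] .
    have perSm: "periodic m S" using periodic_periods[OF m(3)] .
    have perTm: "periodic m T"
      unfolding periodic_def
    proof (intro allI impI)
      fix x y assume xy: "[x = y] (mod m)" "x \<in> T"
      obtain a b where ab: "[f0 a = x] (mod n)" "[f0 b = y] (mod n)" using ciso_surj[OF f(1)] by meson
      then have "[f0 a = x] (mod m)" "[f0 b = y] (mod m)" using m(2) cong_dvd_modulus by blast+
      then have "[f0 a = f0 b] (mod m)" using xy(1) cong_sym cong_trans by meson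
      then have "[a = b] (mod m)" using pres by blast
      moreover have "f0 a \<in> T" using xy(2) ab(1) periodicD[OF perT] by blast
      then have "a \<in> S" using ciso_mem[OF f(1) perT] f(2) by simp
      ultimately have "b \<in> S" using periodicD[OF perSm] by blast
      then have "f0 b \<in> T" using ciso_mem[OF f(1) perT] f(2) by simp
      then show "y \<in> T" using ab(2) periodicD[OF perT] by blast
    qed
    have "circulant m S" using circulant_saturate[OF is_block_m] saturate_periodic[OF perSm] by simp
    moreover have "ciso m S T f0"
      using ciso_saturate[OF f(1) perT m(2) pres] saturate_periodic[OF perSm] saturate_periodic[OF perTm] by simp
    ultimately obtain u where u: "coprime u m" "T = dilate m u S" using IH[OF mn _ perTm] by blast
    \<comment> \<open>The multiplier found modulo \<open>m\<close> need not be a unit modulo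
      \<open>n\<close>, but some integer in its class modulo \<open>m\<close> is.\<close>
    obtain v where v: "coprime v n" "[v = u] (mod m)" by (rule lift_unit[OF n_pos m(2) u(1)])
    have "T = dilate n v S"
      using u(2) dilate_cong[OF v(2)] dilate_periodic_divisor[OF perSm m(2) v(1)] by simp
    then show ?thesis using v(1) by blast
  next
    case True
    show ?thesis
    proof (cases "\<forall>p. Factorial_Ring.prime p \<longrightarrow> p dvd n \<longrightarrow> is_block p")
      case True
      then show ?thesis using f by (intro multiplier_of_units[OF f(1) _ perT]) simp_all
    next
      case False
      then obtain p where p: "Factorial_Ring.prime p" "p dvd n" "\<not> is_block p" by blast
      have p1: "p > 1" using p(1) prime_gt_1_int by blast
      then have pn: "int (nat p) = p" by simp
      have primen: "Factorial_Ring.prime (nat p)" using p(1) prime_int_nat_transfer[of p] by blast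
      define h where "h = Gcd (insert n (exceptional (nat p)))"
      have is_block_h: "is_block h" unfolding h_def by (rule is_block_exceptional[OF primen])
      then have hn: "h > 0" "h dvd n" by (simp_all add: is_block_def)
      have "p dvd h" unfolding h_def
        by (rule Gcd_greatest) (use p(2) exceptional_dvd[of "nat p"] pn in auto)
      then obtain k where k: "h = p * k" by blast
      have k0: "k > 0" using k hn(1) p1 by (simp add: zero_less_mult_iff)
      have k1: "k > 1" using k0 k p(3) is_block_h by (cases "k = 1") auto
      obtain r where r: "n = h * r" using hn(2) by blast
      have "r > 0" using r hn(1) n_pos by (simp add: zero_less_mult_iff)
      define q where "q = k * r"
      have q0: "q > 0" using k0 \<open>r > 0\<close> by (simp add: q_def)
      have nq: "n = int (nat p) * q" using p1 by (simp add: r k q_def)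
      \<comment> \<open>\<open>p * s\<close> is in \<open>H\<close> only if \<open>s\<close> is in
        \<open>K\<close>, so points outside \<open>K\<close> are unexceptional.\<close>
      have off: "s + q \<in> S" if "s \<in> S" "\<not> k dvd s" for s
      proof (rule shift_unexceptional[OF primen nq that(1)])
        show "int (nat p) * s \<notin> exceptional (nat p)"
        proof
          assume "int (nat p) * s \<in> exceptional (nat p)"
          then have "h dvd p * s" unfolding h_def pn by (intro Gcd_dvd) simp
          then show False using that(2) k p1 by simp
        qed
      qed
      have meets: "\<exists>s\<in>S. k dvd s"
      proof (rule ccontr)
        assume "\<not> ?thesis"
        then have "q \<in> periods S" using off by (intro periodsI[OF n_pos per]) blast
        then have "n dvd q" using m(3) \<open>m = n\<close> by simp
        then have "n \<le> q" using q0 by (rule zdvd_imp_le)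
        moreover have "1 * q < p * q" using p1 q0 by (intro mult_strict_right_mono)
        ultimately show False using nq pn by simp
      qed
      then obtain s0 where s0: "s0 \<in> S" by blast
      interpret fibred_orbit n S p k h q r s0
        by unfold_locales (use p(1) k k1 r q_def is_block_h off meets m(3) \<open>m = n\<close> s0 in auto)
      obtain c where c: "is_block c" "coprime c h" "n = c * h"
        and per_off: "\<And>s t. s \<in> S \<Longrightarrow> \<not> h dvd t \<Longrightarrow> [s = t] (mod c) \<Longrightarrow> t \<in> S"
        using complement by metis
      have c0: "c > 0" "c dvd n" using c(1) by (simp_all add: is_block_def)
      have "c * 1 < c * h" using c0(1) basic_facts(2) by (intro mult_strict_left_mono)
      then have cn: "c < n" using c(3) by simp
      have pres: "[f0 x = f0 y] (mod c) \<longleftrightarrow> [x = y] (mod c)" for x y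
        using is_block_transport[OF c(1) f(1) perT] .
      have hf: "h dvd f0 x \<longleftrightarrow> h dvd x" for x
        using is_block_transport[OF is_block_h f(1) perT, of x 0] f(2) by (simp add: cong_0_iff)
      have memT: "f0 x \<in> T \<longleftrightarrow> x \<in> S" for x using ciso_mem[OF f(1) perT] f(2) by simp
      obtain u where u: "coprime u c" "saturate c T = dilate c u (saturate c S)"
        using IH[OF cn circulant_saturate[OF c(1)] periodic_saturate ciso_saturate[OF f(1) perT c0(2) pres]] by blast
      obtain v where v: "coprime v n" "[v = u] (mod c)" by (rule lift_unit[OF n_pos c0(2) u(1)])
      have blurT: "saturate c T = dilate n v (saturate c S)"
        using u(2) dilate_cong[OF v(2)] dilate_periodic_divisor[OF periodic_saturate c0(2) v(1)] by simp
      \<comment> \<open>\<open>S\<close> is its saturation modulo \<open>c\<close> with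
        \<open>H\<close> removed. \<open>f0\<close> respects both \<open>H\<close> and the classes
        modulo \<open>c\<close>, so \<open>T\<close> has the same shape.\<close>
      have T_iff: "t \<in> T \<longleftrightarrow> \<not> h dvd t \<and> t \<in> saturate c T" for t
      proof -
        obtain x where x: "[f0 x = t] (mod n)" using ciso_surj[OF f(1)] by blast
        then have xh: "[f0 x = t] (mod h)" and xc: "[f0 x = t] (mod c)"
          using hn(2) c0(2) cong_dvd_modulus by blast+
        have 1: "t \<in> T \<longleftrightarrow> x \<in> S" using memT x periodicD[OF perT] by blast
        have 2: "h dvd t \<longleftrightarrow> h dvd x" using hf xh cong_dvd_iff by blast
        show ?thesis
        proof
          assume t: "t \<in> T"
          then have "t \<in> saturate c T" unfolding saturate_def using cong_refl by blast
          then show "\<not> h dvd t \<and> t \<in> saturate c T" using t 1 2 S_not_h by blast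
        next
          assume t: "\<not> h dvd t \<and> t \<in> saturate c T"
          then obtain t' where t': "t' \<in> T" "[t = t'] (mod c)" by (auto simp: saturate_def)
          obtain x' where x': "[f0 x' = t'] (mod n)" using ciso_surj[OF f(1)] by blast
          then have "[f0 x' = t'] (mod c)" using c0(2) cong_dvd_modulus by blast
          then have "[f0 x' = f0 x] (mod c)" using t'(2) xc cong_sym cong_trans by meson
          then have "[x' = x] (mod c)" using pres by blast
          moreover have "x' \<in> S" using memT t'(1) x' periodicD[OF perT] by blast
          moreover have "\<not> h dvd x" using t 2 by blast
          ultimately show "t \<in> T" using per_off 1 by blast
        qed
      qed
      have cop_h: "coprime h v" using v(1) hn(2) by (metis coprime_commute coprime_divisors dvd_refl)
      \<comment> \<open>A unit maps \<open>H\<close> to itself, so dilating commutes with removing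
        \<open>H\<close>.\<close>
      have dilate_iff: "y \<in> dilate n v S \<longleftrightarrow> \<not> h dvd y \<and> y \<in> dilate n v (saturate c S)" for y
      proof
        assume "y \<in> dilate n v S"
        then obtain s where s: "s \<in> S" "[y = v * s] (mod n)" by (auto simp: dilate_def)
        have "[y = v * s] (mod h)" using s(2) hn(2) cong_dvd_modulus by blast
        then have "h dvd y \<longleftrightarrow> h dvd v * s" using cong_dvd_iff by blast
        moreover have "h dvd v * s \<longleftrightarrow> h dvd s" using cop_h by (rule coprime_dvd_mult_right_iff)
        moreover have "s \<in> saturate c S" using s(1) unfolding saturate_def using cong_refl by blast
        ultimately show "\<not> h dvd y \<and> y \<in> dilate n v (saturate c S)"
          using S_not_h s unfolding dilate_def by blast
      next
        assume y: "\<not> h dvd y \<and> y \<in> dilate n v (saturate c S)"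
        then obtain x s where x: "[y = v * x] (mod n)" "[x = s] (mod c)" "s \<in> S" by (auto simp: dilate_def saturate_def)
        have "[y = v * x] (mod h)" using x(1) hn(2) cong_dvd_modulus by blast
        then have "\<not> h dvd x" using y cong_dvd_iff dvd_mult by blast
        then have "x \<in> S" using per_off x(2,3) cong_sym by blast
        then show "y \<in> dilate n v S" using x(1) by (auto simp: dilate_def)
      qed
      have "T = dilate n v S" using T_iff dilate_iff blurT by blast
      then show ?thesis using v(1) by blast
    qed
  qed
qed

section \<open>Translation to cyclic groups\<close>

definition exponents :: "('a, 'b) monoid_scheme \<Rightarrow> 'a \<Rightarrow> 'a set \<Rightarrow> int set" where
  "exponents G g A = {i. g [^]\<^bsub>G\<^esub> i \<in> A}"

context group
begin

lemma pow_eq_iff_cong: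
  fixes i j :: int
  assumes "g \<in> carrier G"
  shows "g [^] i = g [^] j \<longleftrightarrow> [i = j] (mod int (ord g))"
  using assms by (simp add: int_pow_eq cong_iff_dvd_diff dvd_diff_commute)

lemma periodic_exponents: "g \<in> carrier G \<Longrightarrow> periodic (int (ord g)) (exponents G g A)"
  unfolding periodic_def exponents_def using pow_eq_iff_cong by (metis mem_Collect_eq)

lemma cay_arcs_pow:
  fixes i j :: int
  assumes "g \<in> carrier G"
  shows "(g [^] i, g [^] j) \<in> cay_arcs G A \<longleftrightarrow> j - i \<in> exponents G g A"
  using assms by (simp add: cay_arcs_def exponents_def int_pow_diff)

lemma ciso_of_digraph_iso:
  assumes g: "g \<in> carrier G" and surj: "\<And>x. x \<in> carrier G \<Longrightarrow> \<exists>i::int. x = g [^] i"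
    and f: "digraph_iso f (carrier G) (cay_arcs G S) (carrier G) (cay_arcs G T)"
  obtains f' :: "int \<Rightarrow> int" where "ciso (int (ord g)) (exponents G g S) (exponents G g T) f'"
    "\<And>i. g [^] f' i = f (g [^] i)"
proof -
  have bij: "bij_betw f (carrier G) (carrier G)"
    and arcs: "\<And>x y. x \<in> carrier G \<Longrightarrow> y \<in> carrier G \<Longrightarrow>
      (x, y) \<in> cay_arcs G S \<longleftrightarrow> (f x, f y) \<in> cay_arcs G T"
    using f by (auto simp: digraph_iso_def)
  have "\<exists>j::int. g [^] j = f (g [^] i)" for i :: int
    using surj[of "f (g [^] i)"] bij_betwE[OF bij] g by fastforce
  then obtain f' :: "int \<Rightarrow> int" where f': "\<And>i. g [^] f' i = f (g [^] i)" by metis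
  have "ciso (int (ord g)) (exponents G g S) (exponents G g T) f'"
  proof (rule cisoI)
    fix i j :: int
    have "f (g [^] i) = f (g [^] j) \<longleftrightarrow> g [^] i = g [^] j"
      using bij g by (intro inj_on_eq_iff[of f "carrier G"]) (auto simp: bij_betw_def)
    then show "[f' i = f' j] (mod int (ord g)) \<longleftrightarrow> [i = j] (mod int (ord g))"
      using pow_eq_iff_cong[OF g, of "f' i" "f' j"] pow_eq_iff_cong[OF g, of i j] f' by simp
    show "f' j - f' i \<in> exponents G g T \<longleftrightarrow> j - i \<in> exponents G g S"
      using arcs[of "g [^] i" "g [^] j"] cay_arcs_pow[OF g, of i j S] cay_arcs_pow[OF g, of "f' i" "f' j" T] f' g
      by simp
  next
    fix j :: int
    have "g [^] j \<in> f ` carrier G" using bij g by (simp add: bij_betw_def)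
    then obtain x where x: "x \<in> carrier G" "f x = g [^] j" by auto
    obtain i :: int where "x = g [^] i" using surj[OF x(1)] by blast
    then have "g [^] f' i = g [^] j" using f' x(2) by simp
    then show "\<exists>i. [f' i = j] (mod int (ord g))" using pow_eq_iff_cong[OF g] by blast
  qed
  then show thesis using that f' by blast
qed

lemma iso_of_unit:
  assumes g: "g \<in> carrier G" and fin: "finite (carrier G)"
    and surj: "\<And>x. x \<in> carrier G \<Longrightarrow> \<exists>i::int. x = g [^] i"
    and u: "coprime u (int (ord g))"
  shows "(\<lambda>x. x [^] u) \<in> iso G G"
proof (rule isoI)
  show "(\<lambda>x. x [^] u) \<in> hom G G"
  proof (rule homI)
    fix x y assume "x \<in> carrier G" "y \<in> carrier G"
    then obtain i j :: int where "x = g [^] i" "y = g [^] j" using surj by meson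
    then show "(x \<otimes> y) [^] u = x [^] u \<otimes> y [^] u"
      using g by (simp add: int_pow_mult[symmetric] int_pow_pow distrib_right)
  qed simp
  have "inj_on (\<lambda>x. x [^] u) (carrier G)"
  proof (rule inj_onI)
    fix x y assume xy: "x \<in> carrier G" "y \<in> carrier G" "x [^] u = y [^] u"
    then obtain i j :: int where ij: "x = g [^] i" "y = g [^] j" using surj by meson
    then have "[i * u = j * u] (mod int (ord g))"
      using xy(3) g pow_eq_iff_cong[OF g, of "i * u" "j * u"] by (simp add: int_pow_pow)
    then have "[i = j] (mod int (ord g))" using u cong_mult_rcancel by blast
    then show "x = y" using pow_eq_iff_cong[OF g] ij by blast
  qed
  moreover from this have "(\<lambda>x. x [^] u) ` carrier G = carrier G"
    using fin by (intro endo_inj_surj) auto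
  ultimately show "bij_betw (\<lambda>x. x [^] u) (carrier G) (carrier G)" by (simp add: bij_betw_def)
qed

end

theorem theorem1p3:
  fixes G :: "('a, 'b) monoid_scheme" and S :: "'a set"
  assumes "cyclic_group G"
    and "finite (carrier G)"
    and "S \<subseteq> carrier G" and "S \<noteq> {}"
    and "digraph_connected (carrier G) (cay_arcs G S)"
    and "arc_transitive (carrier G) (cay_arcs G S)"
  shows "\<forall>T. T \<subseteq> carrier G \<longrightarrow>
           digraphs_isomorphic (carrier G) (cay_arcs G S) (carrier G) (cay_arcs G T) \<longrightarrow>
           (\<exists>\<alpha>. \<alpha> \<in> iso G G \<and> T = \<alpha> ` S)"
proof (intro allI impI)
  fix T assume T: "T \<subseteq> carrier G"
    and "digraphs_isomorphic (carrier G) (cay_arcs G S) (carrier G) (cay_arcs G T)"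
  then obtain \<phi> where \<phi>: "digraph_iso \<phi> (carrier G) (cay_arcs G S) (carrier G) (cay_arcs G T)"
    by (auto simp: digraphs_isomorphic_def)
  interpret group G using assms(1) by (simp add: cyclic_group_def)
  obtain g where g: "g \<in> carrier G" and gen: "generate G {g} = carrier G"
    using assms(1) by (auto simp: cyclic_group_def)
  have surj: "\<exists>i::int. x = g [^]\<^bsub>G\<^esub> i" if "x \<in> carrier G" for x
    using that generate_pow[OF g] gen by auto
  define n where "n = int (ord g)"
  have n: "n > 0" using ord_ge_1[OF assms(2) g] by (simp add: n_def)
  let ?S = "exponents G g S"
  have perS: "periodic n ?S" and perT: "periodic n (exponents G g T)"
    using periodic_exponents[OF g] by (simp_all add: n_def)
  have "circulant n ?S"
  proof (unfold_locales, fact n, fact perS)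
    fix d assume d: "d dvd n" "\<And>s. s \<in> ?S \<Longrightarrow> d dvd s"
    \<comment> \<open>Along an arc, in either direction, the exponent changes by an element of
      \<open>?S\<close> up to sign and stays divisible by \<open>d\<close>; reaching
      \<open>g\<close> then forces \<open>d\<close> to divide 1.\<close>
    have reach: "\<exists>i. x = g [^]\<^bsub>G\<^esub> i \<and> d dvd i"
      if "(\<one>\<^bsub>G\<^esub>, x) \<in> (cay_arcs G S \<union> (cay_arcs G S)\<inverse>)\<^sup>*" for x
      using that
    proof (induction rule: rtrancl_induct)
      case base
      show ?case by (intro exI[of _ 0]) simp
    next
      case (step y z)
      then obtain i where i: "y = g [^]\<^bsub>G\<^esub> i" "d dvd i" by blast
      have "z \<in> carrier G" using step.hyps(2) by (auto simp: cay_arcs_def)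
      then obtain j :: int where j: "z = g [^]\<^bsub>G\<^esub> j" using surj by blast
      have "j - i \<in> ?S \<or> i - j \<in> ?S"
        using step.hyps(2) cay_arcs_pow[OF g] unfolding i j by auto
      then have "d dvd j - i" using d(2) dvd_diff_commute by blast
      then have "d dvd j" using i(2) by (simp add: dvd_diff_left_iff)
      then show ?case using j by blast
    qed
    have "(\<one>\<^bsub>G\<^esub>, g) \<in> (cay_arcs G S \<union> (cay_arcs G S)\<inverse>)\<^sup>*"
      using assms(5) g by (simp add: digraph_connected_def)
    then obtain i where i: "g [^]\<^bsub>G\<^esub> (1::int) = g [^]\<^bsub>G\<^esub> i" "d dvd i" using reach g by fastforce
    then have "[1 = i] (mod n)" using pow_eq_iff_cong[OF g, of 1 i] by (simp add: n_def)
    then show "is_unit d" using i(2) d(1) cong_dvd_modulus cong_dvd_iff by blast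
  next
    fix s t assume st: "s \<in> ?S" "t \<in> ?S"
    \<comment> \<open>Both arcs start at the identity, so an automorphism carrying one to the other
      fixes it.\<close>
    then have "(\<one>\<^bsub>G\<^esub>, g [^]\<^bsub>G\<^esub> s) \<in> cay_arcs G S" "(\<one>\<^bsub>G\<^esub>, g [^]\<^bsub>G\<^esub> t) \<in> cay_arcs G S"
      using cay_arcs_pow[OF g, of 0 s S] cay_arcs_pow[OF g, of 0 t S] by simp_all
    then obtain f where f: "digraph_iso f (carrier G) (cay_arcs G S) (carrier G) (cay_arcs G S)"
      "f \<one>\<^bsub>G\<^esub> = \<one>\<^bsub>G\<^esub>" "f (g [^]\<^bsub>G\<^esub> s) = g [^]\<^bsub>G\<^esub> t"
      using assms(6) unfolding arc_transitive_def by (metis fst_conv snd_conv prod.inject)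
    obtain f' :: "int \<Rightarrow> int" where f': "ciso n ?S ?S f'" "\<And>i. g [^]\<^bsub>G\<^esub> f' i = f (g [^]\<^bsub>G\<^esub> i)"
      using ciso_of_digraph_iso[OF g surj f(1)] unfolding n_def by metis
    have "g [^]\<^bsub>G\<^esub> f' 0 = g [^]\<^bsub>G\<^esub> (0::int)" "g [^]\<^bsub>G\<^esub> f' s = g [^]\<^bsub>G\<^esub> t"
      using f'(2)[of 0] f'(2)[of s] f(2,3) by simp_all
    then show "\<exists>f. ciso n ?S ?S f \<and> [f 0 = 0] (mod n) \<and> [f s = t] (mod n)"
      using f'(1) pow_eq_iff_cong[OF g] unfolding n_def by blast
  qed
  moreover obtain f' where "ciso n ?S (exponents G g T) f'"
    using ciso_of_digraph_iso[OF g surj \<phi>] unfolding n_def by metis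
  ultimately obtain u where u: "coprime u n" "exponents G g T = dilate n u ?S"
    using circulant_multiplier perT by blast
  have "T = (\<lambda>x. x [^]\<^bsub>G\<^esub> u) ` S"
  proof (intro equalityI subsetI)
    fix t assume t: "t \<in> T"
    then obtain j :: int where j: "t = g [^]\<^bsub>G\<^esub> j" using T surj by blast
    then have "j \<in> dilate n u ?S" using t u(2) by (auto simp: exponents_def)
    then obtain i where i: "i \<in> ?S" "[j = u * i] (mod n)" by (auto simp: dilate_def)
    have "t = g [^]\<^bsub>G\<^esub> (i * u)" using j i(2) pow_eq_iff_cong[OF g] by (simp add: n_def mult.commute)
    then have "t = (g [^]\<^bsub>G\<^esub> i) [^]\<^bsub>G\<^esub> u" using g by (simp add: int_pow_pow)
    then show "t \<in> (\<lambda>x. x [^]\<^bsub>G\<^esub> u) ` S" using i(1) by (auto simp: exponents_def)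
  next
    fix t assume "t \<in> (\<lambda>x. x [^]\<^bsub>G\<^esub> u) ` S"
    then obtain s where s: "s \<in> S" "t = s [^]\<^bsub>G\<^esub> u" by blast
    then obtain i :: int where i: "s = g [^]\<^bsub>G\<^esub> i" using assms(3) surj by blast
    have "u * i \<in> dilate n u ?S" using s(1) i by (auto simp: dilate_def exponents_def)
    then have "g [^]\<^bsub>G\<^esub> (u * i) \<in> T" using u(2) by (auto simp: exponents_def)
    then show "t \<in> T" using s(2) i g by (simp add: int_pow_pow mult.commute)
  qed
  moreover have "(\<lambda>x. x [^]\<^bsub>G\<^esub> u) \<in> iso G G"
    using iso_of_unit[OF g assms(2) surj] u(1) by (simp add: n_def)
  ultimately show "\<exists>\<alpha>. \<alpha> \<in> iso G G \<and> T = \<alpha> ` S" by blast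
qed

end
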